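(* Let $\mathbb G=(\mathbb V,\mathbb E)$ be a countably infinite, locally finite, connected graph with edge weights $\mathbf c_e\ge1$, and fix $x\in\mathbb V$. Suppose that the infinite-volume wired FK-Ising measure ${\sf P}^{\mathbb G,+}_{\rm FK}$ with edge parameters $p_e=1-1/\mathbf c_e$ almost surely has an infinite cluster. Then there exists $C>0$ such that for every finite connected subgraph $D=(V,E)$ of $\mathbb G$ with $x\in V$, $$\mathrm{Var}^1_D(h(x))\le C,$$ where $\mathrm{Var}^1_D$ denotes the variance under $\mathbb P^1_D$.
   Context: Height functions: $\mathbb Z_{\rm odd}=2\mathbb Z+1$. For a finite connected graph $D=(V,E)$ with weights $\mathbf c_e\ge1$, a height function is $h:V\to\mathbb Z_{\rm odd}$ with $|h(v)-h(w)|\le2$ for all edges $\langle v,w\rangle$; its weight is $W(h)=\prod_{e=\langle v,w\rangle\in E}\mathbf c_e^{\mathbb 1\{h(v)=h(w)\}}$. For a finite connected subgraph $D$ of $\mathbb G$, $\partial D$ is the set of vertices of $D$ incident to an edge of $\mathbb E\setminus E$, and $\mathbb P^1_D$ is the probability measure on height functions on $D$ with $h\equiv1$ on $\partial D$ and probabilities proportional to $W(h)$ (weights of $\mathbb G$ restricted to $E$). FK-Ising model: on a finite graph $\mathcal D=(\mathcal V,E)$ with parameters $p_e\in[0,1]$, ${\sf P}_{\rm FK}[\varpi]\propto 2^{c(\varpi)}\prod_{e\in E}p_e^{\mathbb 1\{e\in\varpi\}}(1-p_e)^{\mathbb 1\{e\notin\varpi\}}$ for $\varpi\subset E$, where $c(\varpi)$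 is the number of connected components of $(\mathcal V,\varpi)$; the wired measure on $S\subset\mathcal V$ is the same model on the graph where all vertices of $S$ are identified. ${\sf P}^{\mathbb G,+}_{\rm FK}$ is the weak limit (on $\{0,1\}^{\mathbb E}$, as finite connected $D\uparrow\mathbb G$) of the FK-Ising measures on $D$ wired on $\partial D$; this limit exists and does not depend on the sequence. *)

theory Defs
  imports "HOL-Probability.Probability"
begin

section \<open>Ambient graph\<close>

text \<open>The infinite graph has vertex type 'v and a symmetric irreflexive adjacency
relation adj. Edges are two-element vertex sets.\<close>

definition gedges :: "('v \<Rightarrow> 'v \<Rightarrow> bool) \<Rightarrow> 'v set set" where
  "gedges adj = {{v, w} | v w. adj v w}"

definition locally_finite :: "('v \<Rightarrow> 'v \<Rightarrow> bool) \<Rightarrow> bool" where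
  "locally_finite adj \<longleftrightarrow> (\<forall>v. finite {w. adj v w})"

definition graph_connected :: "('v \<Rightarrow> 'v \<Rightarrow> bool) \<Rightarrow> bool" where
  "graph_connected adj \<longleftrightarrow> (\<forall>v w. (v, w) \<in> {(a, b). adj a b}\<^sup>*)"

text \<open>Finite connected subgraph D = (V,E) of the ambient graph.\<close>

definition fin_conn_subgraph :: "('v \<Rightarrow> 'v \<Rightarrow> bool) \<Rightarrow> 'v set \<Rightarrow> 'v set set \<Rightarrow> bool" where
  "fin_conn_subgraph adj V E \<longleftrightarrow>
     finite V \<and> V \<noteq> {} \<and> E \<subseteq> gedges adj \<and> (\<forall>e\<in>E. e \<subseteq> V) \<and>
     (\<forall>v\<in>V. \<forall>w\<in>V. (v, w) \<in> {(a, b). {a, b} \<in> E}\<^sup>*)"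

text \<open>Boundary: vertices of D incident to an ambient edge not in E.\<close>

definition bdry :: "('v \<Rightarrow> 'v \<Rightarrow> bool) \<Rightarrow> 'v set \<Rightarrow> 'v set set \<Rightarrow> 'v set" where
  "bdry adj V E = {v \<in> V. \<exists>e \<in> gedges adj - E. v \<in> e}"

section \<open>Height functions and the measure P^1_D\<close>

text \<open>Height functions on D with boundary value 1; they are extended by 1 outside V
so that each height function on D has a unique representative.\<close>

definition heights1 :: "('v \<Rightarrow> 'v \<Rightarrow> bool) \<Rightarrow> 'v set \<Rightarrow> 'v set set \<Rightarrow> ('v \<Rightarrow> int) set" where
  "heights1 adj V E = {h. (\<forall>v\<in>V. odd (h v)) \<and> (\<forall>v. v \<notin> V \<longrightarrow> h v = 1)
      \<and> (\<forall>e\<in>E. \<forall>a\<in>e. \<forall>b\<in>e. \<bar>h a - h b\<bar> \<le> 2)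
      \<and> (\<forall>v\<in>bdry adj V E. h v = 1)}"

definition hweight :: "('v set \<Rightarrow> real) \<Rightarrow> 'v set set \<Rightarrow> ('v \<Rightarrow> int) \<Rightarrow> real" where
  "hweight c E h = (\<Prod>e\<in>E. if (\<forall>a\<in>e. \<forall>b\<in>e. h a = h b) then c e else 1)"

definition hexp :: "('v \<Rightarrow> 'v \<Rightarrow> bool) \<Rightarrow> ('v set \<Rightarrow> real) \<Rightarrow> 'v set \<Rightarrow> 'v set set
    \<Rightarrow> (('v \<Rightarrow> int) \<Rightarrow> real) \<Rightarrow> real" where
  "hexp adj c V E f =
     (\<Sum>h\<in>heights1 adj V E. hweight c E h * f h) / (\<Sum>h\<in>heights1 adj V E. hweight c E h)"

text \<open>Variance of h(x) under P^1_D.\<close>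

definition hvar :: "('v \<Rightarrow> 'v \<Rightarrow> bool) \<Rightarrow> ('v set \<Rightarrow> real) \<Rightarrow> 'v set \<Rightarrow> 'v set set \<Rightarrow> 'v \<Rightarrow> real" where
  "hvar adj c V E x =
     hexp adj c V E (\<lambda>h. (real_of_int (h x))\<^sup>2) - (hexp adj c V E (\<lambda>h. real_of_int (h x)))\<^sup>2"

section \<open>Wired FK-Ising model\<close>

text \<open>Number of connected components of (V, w) after identifying all vertices of S.\<close>

definition ncomp_wired :: "'v set \<Rightarrow> 'v set \<Rightarrow> 'v set set \<Rightarrow> nat" where
  "ncomp_wired V S w =
     card (V // (({(a, b). {a, b} \<in> w} \<union> (S \<times> S))\<^sup>*))"

definition fk_weight :: "('v \<Rightarrow> 'v \<Rightarrow> bool) \<Rightarrow> ('v set \<Rightarrow> real) \<Rightarrow> 'v set \<Rightarrow> 'v set set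
    \<Rightarrow> 'v set set \<Rightarrow> real" where
  "fk_weight adj p V E w =
     2 ^ ncomp_wired V (bdry adj V E) w * (\<Prod>e\<in>E. if e \<in> w then p e else 1 - p e)"

text \<open>Probability of an event A (a predicate on the set w \<subseteq> E of open edges) under the
FK-Ising measure on D wired on the boundary of D.\<close>

definition fk_prob :: "('v \<Rightarrow> 'v \<Rightarrow> bool) \<Rightarrow> ('v set \<Rightarrow> real) \<Rightarrow> 'v set \<Rightarrow> 'v set set
    \<Rightarrow> ('v set set \<Rightarrow> bool) \<Rightarrow> real" where
  "fk_prob adj p V E A =
     (\<Sum>w\<in>{w. w \<subseteq> E \<and> A w}. fk_weight adj p V E w) / (\<Sum>w\<in>Pow E. fk_weight adj p V E w)"

text \<open>Exhausting increasing sequence of finite connected subgraphs.\<close>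

definition exhausting :: "('v \<Rightarrow> 'v \<Rightarrow> bool) \<Rightarrow> (nat \<Rightarrow> 'v set) \<Rightarrow> (nat \<Rightarrow> 'v set set) \<Rightarrow> bool" where
  "exhausting adj Vs Es \<longleftrightarrow>
     (\<forall>n. fin_conn_subgraph adj (Vs n) (Es n)) \<and> incseq Vs \<and> incseq Es \<and>
     (\<Union>n. Vs n) = UNIV \<and> (\<Union>n. Es n) = gedges adj"

text \<open>Configuration space {0,1}^E of the ambient graph with the product sigma-algebra.\<close>

definition config_space :: "('v \<Rightarrow> 'v \<Rightarrow> bool) \<Rightarrow> ('v set \<Rightarrow> bool) measure" where
  "config_space adj = PiM (gedges adj) (\<lambda>_. count_space (UNIV :: bool set))"

text \<open>mu is the weak limit of the wired FK measures along every exhausting sequence: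
on the compact space {0,1}^E weak convergence is convergence of all cylinder events.\<close>

definition wired_FK_limit :: "('v \<Rightarrow> 'v \<Rightarrow> bool) \<Rightarrow> ('v set \<Rightarrow> real) \<Rightarrow> ('v set \<Rightarrow> bool) measure \<Rightarrow> bool" where
  "wired_FK_limit adj p \<mu> \<longleftrightarrow>
     prob_space \<mu> \<and> sets \<mu> = sets (config_space adj) \<and>
     (\<forall>F \<eta> Vs Es. finite F \<and> F \<subseteq> gedges adj \<and> \<eta> \<subseteq> F \<and> exhausting adj Vs Es \<longrightarrow>
        (\<lambda>n. fk_prob adj p (Vs n) (Es n) (\<lambda>w. w \<inter> F = \<eta>))
          \<longlonglongrightarrow> measure \<mu> {\<omega> \<in> space (config_space adj). \<forall>e\<in>F. \<omega> e \<longleftrightarrow> e \<in> \<eta>})"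

definition has_inf_cluster :: "('v \<Rightarrow> 'v \<Rightarrow> bool) \<Rightarrow> ('v set \<Rightarrow> bool) \<Rightarrow> bool" where
  "has_inf_cluster adj \<omega> \<longleftrightarrow>
     (\<exists>v. infinite {w. (v, w) \<in> {(a, b). adj a b \<and> \<omega> {a, b}}\<^sup>*})"

end

theory Submission
  imports Defs
begin

text \<open>Given \<open>|h|\<close>, the sign of \<open>h\<close> is an Ising model whose FK representation dominates the wired
  FK-Ising model with parameters \<open>1 - 1 / c e\<close>. If the latter percolates, some vertex \<open>v\<close> has probability at
  least \<open>\<theta> > 0\<close> to be connected to the boundary in every finite domain, so \<open>E[sgn h(v)] \<ge> \<theta>\<close>;
  by the symmetry \<open>h \<mapsto> 2 - h\<close> this expectation equals \<open>P[h(v) = 1]\<close>. The potential is convex because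
  \<open>c e \<ge> 1\<close>, so the four functions theorem makes the law of \<open>h(v)\<close> log-concave, and a symmetric
  log-concave law with an atom of mass at least \<open>\<theta>\<close> at its centre has variance bounded in terms
  of \<open>\<theta>\<close>. The four functions theorem also yields the comparison of FK-Ising measures.\<close>

section \<open>The four functions theorem\<close>

text \<open>The difficulty is uniformity: one constant must serve all domains. Two monotonicities
  handle it. Enlarging the domain moves the wiring away and lowers wired FK probabilities of
  increasing events, so the infinite-volume probability is a lower bound in every finite domain.
  Conditioning on \<open>|h|\<close> gives irregular couplings but can only raise the FK parameters:
  an edge whose ends both have absolute height 1 has weight \<open>c e\<close> for equal signs and 1
  for opposite signs, which is parameter \<open>1 - 1 / c e\<close>; on every other edge opposite
  signs would mean heights at distance at least 4, so the signs agree and the parameter is 1. A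
  bound on the mean sign looks weak, as it sees one bit of \<open>h v\<close>. The boundary value 1
  makes it strong: the law is symmetric about 1 while the sign is antisymmetric about 0, and the
  only odd height which this mismatch leaves over is 1. Log-concavity then turns the single atom
  into control of the tails.\<close>

definition box_funs :: "'i set \<Rightarrow> 'b set \<Rightarrow> 'b \<Rightarrow> ('i \<Rightarrow> 'b) set" where
  "box_funs I L d = {f. (\<forall>i\<in>I. f i \<in> L) \<and> (\<forall>i. i \<notin> I \<longrightarrow> f i = d)}"

lemma box_funs_empty: "box_funs {} L d = {\<lambda>_. d}"
  by (auto simp: box_funs_def)

lemma bij_betw_box_funs_insert:
  assumes "i \<notin> I"
  shows "bij_betw (\<lambda>(f, x). f(i := x)) (box_funs I L d \<times> L) (box_funs (insert i I) L d)"
proof (rule bij_betwI[where g = "\<lambda>f. (f(i := d), f i)"])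
  show "(\<lambda>(f, x). f(i := x)) \<in> box_funs I L d \<times> L \<rightarrow> box_funs (insert i I) L d"
    by (auto simp: box_funs_def)
  show "(\<lambda>f. (f(i := d), f i)) \<in> box_funs (insert i I) L d \<rightarrow> box_funs I L d \<times> L"
    using assms by (auto simp: box_funs_def)
qed (use assms in \<open>auto simp: box_funs_def fun_eq_iff\<close>)

lemma sum_box_funs_insert:
  assumes "i \<notin> I"
  shows "(\<Sum>f\<in>box_funs (insert i I) L d. F f) = (\<Sum>f\<in>box_funs I L d. \<Sum>x\<in>L. F (f(i := x)))"
  using sum.reindex_bij_betw[OF bij_betw_box_funs_insert[OF assms], of F L d, symmetric]
  by (simp add: sum.cartesian_product case_prod_unfold)

lemma finite_box_funs:
  assumes "finite I" "finite L"
  shows "finite (box_funs I L d)"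
  using assms(1)
proof induction
  case (insert i I)
  then show ?case
    using bij_betw_finite[OF bij_betw_box_funs_insert[OF insert(2), of L d]] assms(2) by auto
qed (simp add: box_funs_empty)

text \<open>For \<open>C > 0\<close>, expanding \<open>(C - A) * (C - B) \<ge> 0\<close> gives
  \<open>C * (A + B) \<le> C * C + A * B\<close>, and the product hypothesis replaces
  \<open>A * B\<close> by \<open>C * D\<close>.\<close>

lemma add_le_add_of_mult_le:
  fixes A B C D :: real
  assumes "0 \<le> A" "0 \<le> B" "0 \<le> D" "A \<le> C" "B \<le> C" "A * B \<le> C * D"
  shows "A + B \<le> C + D"
proof (cases "C = 0")
  case True
  then show ?thesis using assms by auto
next
  case False
  then have "C > 0" using assms by linarith
  have "0 \<le> (C - A) * (C - B)" using assms by simp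
  then have "C * (A + B) \<le> C * (C + D)"
    using assms(6) by (simp add: algebra_simps)
  then show ?thesis using \<open>C > 0\<close> by simp
qed

text \<open>Doubling the product of sums pairs \<open>(x, y)\<close> with \<open>(y, x)\<close>. For
  \<open>x \<le> y\<close> the term \<open>\<gamma> y * \<delta> x\<close> dominates both mixed
  products, and the diagonal hypotheses at \<open>x\<close> and \<open>y\<close> bound their
  product, so \<open>add_le_add_of_mult_le\<close> applies.\<close>

lemma four_functions_chain:
  fixes \<alpha> \<beta> \<gamma> \<delta> :: "'b::linorder \<Rightarrow> real"
  assumes nonneg: "\<And>x. 0 \<le> \<alpha> x" "\<And>x. 0 \<le> \<beta> x" "\<And>x. 0 \<le> \<gamma> x" "\<And>x. 0 \<le> \<delta> x"
    and le: "\<And>x y. x \<in> L \<Longrightarrow> y \<in> L \<Longrightarrow> \<alpha> x * \<beta> y \<le> \<gamma> (max x y) * \<delta> (min x y)"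
  shows "sum \<alpha> L * sum \<beta> L \<le> sum \<gamma> L * sum \<delta> L"
proof -
  have pair: "\<alpha> x * \<beta> y + \<alpha> y * \<beta> x \<le> \<gamma> x * \<delta> y + \<gamma> y * \<delta> x"
    if "x \<in> L" "y \<in> L" "x \<le> y" for x y
  proof -
    have "(\<alpha> x * \<beta> x) * (\<alpha> y * \<beta> y) \<le> (\<gamma> x * \<delta> x) * (\<gamma> y * \<delta> y)"
      by (rule mult_mono) (use le[of x x] le[of y y] that nonneg in auto)
    then have "(\<alpha> x * \<beta> y) * (\<alpha> y * \<beta> x) \<le> (\<gamma> y * \<delta> x) * (\<gamma> x * \<delta> y)"
      by (simp add: mult_ac)
    moreover have "\<alpha> x * \<beta> y \<le> \<gamma> y * \<delta> x" "\<alpha> y * \<beta> x \<le> \<gamma> y * \<delta> x"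
      using le[of x y] le[of y x] that by (auto simp: max_def min_def split: if_splits)
    ultimately show ?thesis
      using add_le_add_of_mult_le[of "\<alpha> x * \<beta> y" "\<alpha> y * \<beta> x" "\<gamma> x * \<delta> y" "\<gamma> y * \<delta> x"] nonneg
      by simp
  qed
  have pair': "\<alpha> x * \<beta> y + \<alpha> y * \<beta> x \<le> \<gamma> x * \<delta> y + \<gamma> y * \<delta> x"
    if "x \<in> L" "y \<in> L" for x y
    using pair[of x y] pair[of y x] that by (cases "x \<le> y") (auto simp: add.commute)
  have double: "2 * (sum u L * sum v L) = (\<Sum>x\<in>L. \<Sum>y\<in>L. u x * v y + u y * v x)"
    for u v :: "'b \<Rightarrow> real"
    by (simp add: sum.distrib sum_product sum.swap[of "\<lambda>x y. u y * v x"])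
  have "2 * (sum \<alpha> L * sum \<beta> L) \<le> 2 * (sum \<gamma> L * sum \<delta> L)"
    unfolding double by (intro sum_mono pair')
  then show ?thesis by simp
qed

text \<open>The Ahlswede-Daykin inequality, with coordinates in any linear order because heights
  take more than two values. Summing out one coordinate preserves the hypothesis by the chain case,
  so the induction generalises over the four functions.\<close>

theorem four_functions:
  fixes \<alpha> \<beta> \<gamma> \<delta> :: "('i \<Rightarrow> 'b::linorder) \<Rightarrow> real"
  assumes "finite I"
    and "\<And>f. 0 \<le> \<alpha> f" "\<And>f. 0 \<le> \<beta> f" "\<And>f. 0 \<le> \<gamma> f" "\<And>f. 0 \<le> \<delta> f"
    and "\<And>f g. f \<in> box_funs I L d \<Longrightarrow> g \<in> box_funs I L d \<Longrightarrow>
           \<alpha> f * \<beta> g \<le> \<gamma> (\<lambda>i. max (f i) (g i)) * \<delta> (\<lambda>i. min (f i) (g i))"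
  shows "sum \<alpha> (box_funs I L d) * sum \<beta> (box_funs I L d) \<le> sum \<gamma> (box_funs I L d) * sum \<delta> (box_funs I L d)"
  using assms
proof (induction I arbitrary: \<alpha> \<beta> \<gamma> \<delta> rule: finite_induct)
  case empty
  then show ?case by (simp add: box_funs_empty)
next
  case (insert i I)
  have mx: "(\<lambda>j. max ((f(i := x)) j) ((g(i := y)) j)) = (\<lambda>j. max (f j) (g j))(i := max x y)"
    "(\<lambda>j. min ((f(i := x)) j) ((g(i := y)) j)) = (\<lambda>j. min (f j) (g j))(i := min x y)"
    for f g :: "'i \<Rightarrow> 'b" and x y by auto
  have in_box: "f(i := x) \<in> box_funs (insert i I) L d" if "f \<in> box_funs I L d" "x \<in> L" for f x
    using that by (auto simp: box_funs_def)
  show ?case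
    unfolding sum_box_funs_insert[OF insert.hyps(2)]
  proof (rule insert.IH)
    fix f g assume "f \<in> box_funs I L d" "g \<in> box_funs I L d"
    then have "\<alpha> (f(i := x)) * \<beta> (g(i := y)) \<le>
        \<gamma> ((\<lambda>j. max (f j) (g j))(i := max x y)) * \<delta> ((\<lambda>j. min (f j) (g j))(i := min x y))"
      if "x \<in> L" "y \<in> L" for x y
      using insert.prems(5)[of "f(i := x)" "g(i := y)"] in_box that by (simp only: mx)
    then show "(\<Sum>x\<in>L. \<alpha> (f(i := x))) * (\<Sum>x\<in>L. \<beta> (g(i := x))) \<le>
        (\<Sum>x\<in>L. \<gamma> ((\<lambda>j. max (f j) (g j))(i := x))) * (\<Sum>x\<in>L. \<delta> ((\<lambda>j. min (f j) (g j))(i := x)))"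
      using insert.prems(1-4) by (intro four_functions_chain) auto
  qed (use insert.prems(1-4) in \<open>auto intro!: sum_nonneg\<close>)
qed

lemma bij_betw_box_funs_bool: "bij_betw Collect (box_funs E UNIV False) (Pow E)"
  by (rule bij_betwI[where g = "\<lambda>w e. e \<in> w"]) (auto simp: box_funs_def)

corollary four_functions_Pow:
  fixes \<alpha> \<beta> \<gamma> \<delta> :: "'a set \<Rightarrow> real"
  assumes "finite E"
    and "\<And>w. 0 \<le> \<alpha> w" "\<And>w. 0 \<le> \<beta> w" "\<And>w. 0 \<le> \<gamma> w" "\<And>w. 0 \<le> \<delta> w"
    and "\<And>w w'. w \<subseteq> E \<Longrightarrow> w' \<subseteq> E \<Longrightarrow> \<alpha> w * \<beta> w' \<le> \<gamma> (w \<union> w') * \<delta> (w \<inter> w')"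
  shows "sum \<alpha> (Pow E) * sum \<beta> (Pow E) \<le> sum \<gamma> (Pow E) * sum \<delta> (Pow E)"
proof -
  let ?B = "box_funs E (UNIV :: bool set) False"
  have *: "Collect (\<lambda>e. max (f e) (g e)) = Collect f \<union> Collect g"
    "Collect (\<lambda>e. min (f e) (g e)) = Collect f \<inter> Collect g" for f g :: "'a \<Rightarrow> bool"
    by (auto simp: max_def min_def)
  have "sum u (Pow E) = (\<Sum>f\<in>box_funs E UNIV False. u (Collect f))" for u :: "'a set \<Rightarrow> real"
    using sum.reindex_bij_betw[OF bij_betw_box_funs_bool, of u E] by simp
  moreover have "(\<Sum>f\<in>?B. \<alpha> (Collect f)) * (\<Sum>f\<in>?B. \<beta> (Collect f)) \<le>
      (\<Sum>f\<in>?B. \<gamma> (Collect f)) * (\<Sum>f\<in>?B. \<delta> (Collect f))"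
    using assms(1)
  proof (rule four_functions)
    fix f g assume "f \<in> ?B" "g \<in> ?B"
    then show "\<alpha> (Collect f) * \<beta> (Collect g) \<le>
        \<gamma> (Collect (\<lambda>e. max (f e) (g e))) * \<delta> (Collect (\<lambda>e. min (f e) (g e)))"
      using assms(6)[of "Collect f" "Collect g"] by (auto simp: * box_funs_def)
  qed (use assms(2-5) in auto)
  ultimately show ?thesis by simp
qed

section \<open>The wired FK-Ising model\<close>

text \<open>The sets of plus spins that are constant on wired clusters. There are \<open>2\<close> to the number of clusters
  of them, and they form a group under symmetric difference, which gives supermodularity.\<close>

definition spin_sets :: "'v set \<Rightarrow> 'v set \<Rightarrow> 'v set set \<Rightarrow> 'v set set" where
  "spin_sets V S w = {A. A \<subseteq> V \<and> (\<forall>a b. {a, b} \<in> w \<longrightarrow> a \<in> A \<longrightarrow> b \<in> A) \<and> (S \<subseteq> A \<or> S \<inter> A = {})}"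

lemma finite_spin_sets: "finite V \<Longrightarrow> finite (spin_sets V S w)"
  by (rule finite_subset[of _ "Pow V"]) (auto simp: spin_sets_def)

lemma spin_sets_edge:
  assumes "A \<in> spin_sets V S w" "{a, b} \<in> w"
  shows "a \<in> A \<longleftrightarrow> b \<in> A"
proof -
  have "{b, a} \<in> w" using assms(2) by (simp add: insert_commute)
  then show ?thesis using assms by (auto simp: spin_sets_def)
qed

lemma spin_sets_rtrancl:
  assumes "A \<in> spin_sets V S w" "a \<in> A" "(a, b) \<in> ({(a, b). {a, b} \<in> w} \<union> S \<times> S)\<^sup>*"
  shows "b \<in> A"
  using assms(3,2)
proof induction
  case (step b c)
  then show ?case using assms(1) by (auto simp: spin_sets_def)
qed simp

text \<open>Spin sets are exactly the unions of classes of \<open>r\<close> that start in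
  \<open>V\<close>. Classes are nonempty and disjoint, so \<open>Union\<close> maps the subsets of
  \<open>V // r\<close> bijectively to spin sets.\<close>

lemma two_power_ncomp_wired:
  assumes "finite V" "S \<subseteq> V" "\<forall>e\<in>w. e \<subseteq> V"
  shows "2 ^ ncomp_wired V S w = card (spin_sets V S w)"
proof -
  define r where "r = ({(a, b). {a, b} \<in> w} \<union> S \<times> S)\<^sup>*"
  have "sym ({(a, b). {a, b} \<in> w} \<union> S \<times> S)"
    by (auto simp: sym_def insert_commute)
  then have sym: "sym r" unfolding r_def by (rule sym_rtrancl)
  have trans: "trans r" unfolding r_def by (rule trans_rtrancl)
  have refl: "(a, a) \<in> r" for a unfolding r_def by simp
  have in_V: "b \<in> V" if "(a, b) \<in> r" "a \<in> V" for a b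
    using that unfolding r_def
  proof (induction rule: rtrancl_induct)
    case (step b c)
    then show ?case using assms(2,3) by auto
  qed simp
  have class_eq: "r `` {a} = r `` {b}" if "(a, b) \<in> r" for a b
  proof (rule equiv_class_eq[OF _ that])
    show "equiv UNIV r" by (rule equivI) (auto simp: refl_on_def sym trans refl)
  qed
  have inj: "inj_on Union (Pow (V // r))"
  proof (rule inj_on_inverseI[where g = "\<lambda>A. {X \<in> V // r. X \<subseteq> A}"])
    fix C assume C: "C \<in> Pow (V // r)"
    have "X \<in> C" if X: "X \<in> V // r" "X \<subseteq> \<Union>C" for X
    proof -
      obtain a where a: "X = r `` {a}" "a \<in> V" using X(1) by (auto simp: quotient_def)
      then obtain Y where Y: "Y \<in> C" "a \<in> Y" using X(2) refl by auto
      then obtain b where "Y = r `` {b}" using C by (auto simp: quotient_def)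
      then show ?thesis using Y a class_eq[of b a] by auto
    qed
    then show "{X \<in> V // r. X \<subseteq> \<Union>C} = C" using C by auto
  qed
  have "Union ` Pow (V // r) = spin_sets V S w"
  proof (intro equalityI subsetI)
    fix A assume "A \<in> Union ` Pow (V // r)"
    then obtain C where C: "C \<subseteq> V // r" "A = \<Union>C" by auto
    have closed: "b \<in> A" if ab: "a \<in> A" "(a, b) \<in> r" for a b
    proof -
      obtain X where "X \<in> C" "a \<in> X" using ab C by auto
      moreover obtain d where "X = r `` {d}" using \<open>X \<in> C\<close> C by (auto simp: quotient_def)
      ultimately have "b \<in> X" using transD[OF trans _ ab(2)] by simp
      then show ?thesis using \<open>X \<in> C\<close> C by auto
    qed
    have "X \<subseteq> V" if "X \<in> V // r" for X
      using that in_V by (auto simp: quotient_def)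
    then have "A \<subseteq> V" using C by auto
    moreover have "b \<in> A" if "{a, b} \<in> w" "a \<in> A" for a b
      by (rule closed[OF that(2)]) (use that in \<open>auto simp: r_def\<close>)
    moreover have "S \<subseteq> A" if "a \<in> S" "a \<in> A" for a
      using closed[OF that(2)] that(1) by (auto simp: r_def)
    then have "S \<subseteq> A \<or> S \<inter> A = {}" by blast
    ultimately show "A \<in> spin_sets V S w" unfolding spin_sets_def by simp
  next
    fix A assume A: "A \<in> spin_sets V S w"
    have "r `` {a} \<subseteq> A" if "a \<in> A" for a
      using spin_sets_rtrancl[OF A that] unfolding r_def by auto
    moreover have "A \<subseteq> V" using A by (auto simp: spin_sets_def)
    ultimately have "A = \<Union>((\<lambda>a. r `` {a}) ` A)"
      using refl by blast
    moreover have "(\<lambda>a. r `` {a}) ` A \<in> Pow (V // r)"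
      using \<open>A \<subseteq> V\<close> by (auto simp: quotient_def)
    ultimately show "A \<in> Union ` Pow (V // r)" by (rule image_eqI)
  qed
  then have "card (spin_sets V S w) = card (Pow (V // r))"
    using card_image[OF inj] by simp
  also have "\<dots> = 2 ^ card (V // r)"
  proof (rule card_Pow)
    have "V // r = (\<lambda>a. r `` {a}) ` V" by (auto simp: quotient_def)
    then show "finite (V // r)" using assms(1) by simp
  qed
  finally show ?thesis by (simp add: ncomp_wired_def r_def)
qed

text \<open>For subgroups \<open>\<A>\<close>, \<open>\<B>\<close> of an elementary abelian 2-group:
  \<open>|\<A>| |\<B>| = |\<A> \<inter> \<B>| |\<A> + \<B>|\<close>.\<close>

lemma card_sym_diff_closed_mult_le:
  fixes \<A> \<B> \<C> :: "'a set set"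
  assumes fin: "finite \<A>" "finite \<B>" "finite \<C>"
    and \<A>: "\<And>A B. A \<in> \<A> \<Longrightarrow> B \<in> \<A> \<Longrightarrow> (A - B) \<union> (B - A) \<in> \<A>"
    and \<B>: "\<And>A B. A \<in> \<B> \<Longrightarrow> B \<in> \<B> \<Longrightarrow> (A - B) \<union> (B - A) \<in> \<B>"
    and \<C>: "\<And>A B. A \<in> \<A> \<Longrightarrow> B \<in> \<B> \<Longrightarrow> (A - B) \<union> (B - A) \<in> \<C>"
  shows "card \<A> * card \<B> \<le> card (\<A> \<inter> \<B>) * card \<C>"
proof -
  define fib where "fib C = {(A, B) \<in> \<A> \<times> \<B>. (A - B) \<union> (B - A) = C}" for C
  have fib_le: "card (fib C) \<le> card (\<A> \<inter> \<B>)" for C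
  proof (cases "fib C = {}")
    case False
    then obtain A0 B0 where AB0: "A0 \<in> \<A>" "B0 \<in> \<B>" "(A0 - B0) \<union> (B0 - A0) = C"
      by (auto simp: fib_def)
    show ?thesis
    \<comment> \<open>Translate by the base point \<open>(A0, B0)\<close> of the fibre. Writing +
      for symmetric difference, \<open>A + B = A0 + B0\<close> forces
      \<open>A + A0 = B + B0\<close>, an element of both groups. Adding \<open>A0\<close> again
      recovers \<open>A\<close>, and adding \<open>C\<close> to that recovers
      \<open>B\<close>.\<close>
    proof (rule card_inj_on_le[where f = "\<lambda>(A, B). (A - A0) \<union> (A0 - A)"])
      show "inj_on (\<lambda>(A, B). (A - A0) \<union> (A0 - A)) (fib C)"
        by (rule inj_on_inverseI[where g = "\<lambda>D. ((D - A0) \<union> (A0 - D),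
              (((D - A0) \<union> (A0 - D)) - C) \<union> (C - ((D - A0) \<union> (A0 - D))))"])
          (auto simp: fib_def)
      have "(A - A0) \<union> (A0 - A) = (B - B0) \<union> (B0 - B)" if "(A, B) \<in> fib C" for A B
        using that AB0(3) unfolding fib_def by auto
      then show "(\<lambda>(A, B). (A - A0) \<union> (A0 - A)) ` fib C \<subseteq> \<A> \<inter> \<B>"
        using \<A>[OF _ AB0(1)] \<B>[OF _ AB0(2)] by (fastforce simp: fib_def)
    qed (use fin in auto)
  qed simp
  have "\<A> \<times> \<B> = (\<Union>C\<in>\<C>. fib C)" using \<C> by (auto simp: fib_def)
  then have "card \<A> * card \<B> = card (\<Union>C\<in>\<C>. fib C)"
    by (metis card_cartesian_product)
  also have "\<dots> \<le> (\<Sum>C\<in>\<C>. card (fib C))" by (rule card_UN_le[OF fin(3)])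
  also have "\<dots> \<le> (\<Sum>C\<in>\<C>. card (\<A> \<inter> \<B>))" by (intro sum_mono fib_le)
  finally show ?thesis by (simp add: mult.commute)
qed

text \<open>Open edges and wiring are linear constraints over the field with two elements. Imposing
  both systems gives the intersection of the two groups, and their sum still satisfies the common
  constraints. Allowing \<open>S \<subseteq> S'\<close> lets the same inequality compare boundary
  conditions.\<close>

lemma card_spin_sets_supermodular:
  assumes "finite V" "S \<subseteq> S'"
  shows "card (spin_sets V S w) * card (spin_sets V S' w')
    \<le> card (spin_sets V S' (w \<union> w')) * card (spin_sets V S (w \<inter> w'))"
proof -
  have closed: "(A - B) \<union> (B - A) \<in> spin_sets V S w"
    if "A \<in> spin_sets V S w" "B \<in> spin_sets V S w" for A B :: "'a set" and S w
    using that spin_sets_edge[OF that(1)] spin_sets_edge[OF that(2)]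
    unfolding spin_sets_def by blast
  have mono: "A \<in> spin_sets V S (w \<inter> w')" if "A \<in> spin_sets V S w \<or> A \<in> spin_sets V S' w'" for A
    using that assms(2) unfolding spin_sets_def by blast
  have "spin_sets V S w \<inter> spin_sets V S' w' = spin_sets V S' (w \<union> w')"
    using assms(2) unfolding spin_sets_def by blast
  then show ?thesis
    using card_sym_diff_closed_mult_le[of "spin_sets V S w" "spin_sets V S' w'" "spin_sets V S (w \<inter> w')"]
      finite_spin_sets[OF assms(1)] closed mono by simp
qed

section \<open>Independent edge weights\<close>

definition edge_prod :: "('e \<Rightarrow> real) \<Rightarrow> 'e set \<Rightarrow> 'e set \<Rightarrow> real" where
  "edge_prod p E w = (\<Prod>e\<in>E. if e \<in> w then p e else 1 - p e)"

lemma edge_prod_nonneg: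
  assumes "\<And>e. e \<in> E \<Longrightarrow> 0 \<le> p e \<and> p e \<le> 1"
  shows "0 \<le> edge_prod p E w"
  unfolding edge_prod_def by (intro prod_nonneg) (use assms in auto)

text \<open>Expand the product: choosing the summand \<open>p e * x e\<close> means opening
  \<open>e\<close>. With \<open>x e\<close> the indicator of equal spins this is the Edwards-Sokal
  expansion.\<close>

lemma sum_edge_prod_mult:
  assumes "finite E"
  shows "(\<Sum>w\<in>Pow E. edge_prod p E w * (\<Prod>e\<in>w. x e)) = (\<Prod>e\<in>E. p e * x e + (1 - p e))"
proof -
  have "edge_prod p E w * (\<Prod>e\<in>w. x e) = (\<Prod>e\<in>w. p e * x e) * (\<Prod>e\<in>E - w. 1 - p e)"
    if "w \<subseteq> E" for w
  proof -
    have "edge_prod p E w = (\<Prod>e\<in>w. p e) * (\<Prod>e\<in>E - w. 1 - p e)"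
      unfolding edge_prod_def using prod.subset_diff[OF that assms, of "\<lambda>e. if e \<in> w then p e else 1 - p e"]
      by (simp add: mult.commute)
    then show ?thesis by (simp add: prod.distrib)
  qed
  then show ?thesis unfolding prod_add[OF assms] by (intro sum.cong) auto
qed

lemma sum_edge_prod: "finite E \<Longrightarrow> (\<Sum>w\<in>Pow E. edge_prod p E w) = 1"
  using sum_edge_prod_mult[of E p "\<lambda>_. 1"] by simp

text \<open>Edges are independent under \<open>edge_prod\<close>, so those outside \<open>E\<close>
  sum to 1 when \<open>F\<close> sees only \<open>w \<inter> E\<close>.\<close>

lemma sum_edge_prod_restrict:
  assumes "finite E'" "E \<subseteq> E'"
  shows "(\<Sum>w\<in>Pow E'. edge_prod p E' w * F (w \<inter> E)) = (\<Sum>w\<in>Pow E. edge_prod p E w * F w)"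
proof -
  have bij: "bij_betw (\<lambda>(u, v). u \<union> v) (Pow E \<times> Pow (E' - E)) (Pow E')"
    by (rule bij_betwI[where g = "\<lambda>w. (w \<inter> E, w - E)"]) (use assms(2) in auto)
  have split: "edge_prod p E' (u \<union> v) = edge_prod p E u * edge_prod p (E' - E) v"
    if "u \<subseteq> E" "v \<subseteq> E' - E" for u v
  proof -
    have "edge_prod p E' (u \<union> v) = edge_prod p (E' - E) (u \<union> v) * edge_prod p E (u \<union> v)"
      unfolding edge_prod_def by (rule prod.subset_diff[OF assms(2,1)])
    also have "edge_prod p (E' - E) (u \<union> v) = edge_prod p (E' - E) v"
      unfolding edge_prod_def by (intro prod.cong) (use that in auto)
    also have "edge_prod p E (u \<union> v) = edge_prod p E u"
      unfolding edge_prod_def by (intro prod.cong) (use that in auto)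
    finally show ?thesis by simp
  qed
  have "(\<Sum>w\<in>Pow E'. edge_prod p E' w * F (w \<inter> E)) =
      (\<Sum>(u, v)\<in>Pow E \<times> Pow (E' - E). edge_prod p E' (u \<union> v) * F ((u \<union> v) \<inter> E))"
    using sum.reindex_bij_betw[OF bij, of "\<lambda>w. edge_prod p E' w * F (w \<inter> E)", symmetric]
    by (simp add: case_prod_unfold)
  also have "\<dots> = (\<Sum>(u, v)\<in>Pow E \<times> Pow (E' - E). (edge_prod p E u * F u) * edge_prod p (E' - E) v)"
  proof (intro sum.cong refl)
    fix x assume "x \<in> Pow E \<times> Pow (E' - E)"
    then obtain u v where x: "x = (u, v)" "u \<subseteq> E" "v \<subseteq> E' - E" by auto
    then have "(u \<union> v) \<inter> E = u" by auto
    then show "(case x of (u, v) \<Rightarrow> edge_prod p E' (u \<union> v) * F ((u \<union> v) \<inter> E)) =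
        (case x of (u, v) \<Rightarrow> (edge_prod p E u * F u) * edge_prod p (E' - E) v)"
      using x split by simp
  qed
  also have "\<dots> = (\<Sum>u\<in>Pow E. edge_prod p E u * F u) * (\<Sum>v\<in>Pow (E' - E). edge_prod p (E' - E) v)"
    by (simp add: sum_product sum.cartesian_product)
  finally show ?thesis using sum_edge_prod[of "E' - E" p] assms(1) by simp
qed

text \<open>The number of spin sets stands for 2 to the number of clusters. The wired set is a free
  argument, so it can be varied independently of the domain, which \<open>fk_weight\<close> does not
  permit.\<close>

definition wired_weight :: "'v set \<Rightarrow> 'v set \<Rightarrow> ('v set \<Rightarrow> real) \<Rightarrow> 'v set set \<Rightarrow> 'v set set \<Rightarrow> real" where
  "wired_weight V S p E w = edge_prod p E w * card (spin_sets V S w)"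

text \<open>Stochastic domination of Holley type with denominators cleared. In the four functions
  theorem the union carries the larger parameters, the larger wiring and the event, which passes to
  the union because \<open>A\<close> is increasing.\<close>

theorem wired_weight_comparison:
  assumes fin: "finite V" "finite E" and "S \<subseteq> S'"
    and p: "\<And>e. e \<in> E \<Longrightarrow> 0 \<le> p e \<and> p e \<le> p' e \<and> p' e \<le> 1"
    and incr: "\<And>w w'. A w \<Longrightarrow> w \<subseteq> w' \<Longrightarrow> w' \<subseteq> E \<Longrightarrow> A w'"
  shows "(\<Sum>w\<in>Pow E. wired_weight V S p E w * of_bool (A w)) * (\<Sum>w\<in>Pow E. wired_weight V S' p' E w)
    \<le> (\<Sum>w\<in>Pow E. wired_weight V S' p' E w * of_bool (A w)) * (\<Sum>w\<in>Pow E. wired_weight V S p E w)"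
  using fin(2)
proof (rule four_functions_Pow)
  have nonneg: "0 \<le> wired_weight V S p E w" if "\<And>e. e \<in> E \<Longrightarrow> 0 \<le> p e \<and> p e \<le> 1" for S p w
    using edge_prod_nonneg[of E p w] that by (simp add: wired_weight_def)
  have p01: "0 \<le> p e \<and> p e \<le> 1" "0 \<le> p' e \<and> p' e \<le> 1" if "e \<in> E" for e
    using p[OF that] by linarith+
  show "0 \<le> wired_weight V S p E w" "0 \<le> wired_weight V S' p' E w"
    "0 \<le> wired_weight V S p E w * of_bool (A w)" "0 \<le> wired_weight V S' p' E w * of_bool (A w)" for w
    using nonneg p01 by auto
  fix w w' assume w: "w \<subseteq> E" "w' \<subseteq> E"
  have "edge_prod p E w * edge_prod p' E w' \<le> edge_prod p' E (w \<union> w') * edge_prod p E (w \<inter> w')"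
    unfolding edge_prod_def prod.distrib[symmetric]
  proof (intro prod_mono conjI)
    fix e assume "e \<in> E"
    note pe = p[OF this]
    \<comment> \<open>For \<open>e\<close> in \<open>w - w'\<close> this is
      \<open>p e \<le> p' e\<close> after expansion; in the other three cases the two sides
      agree.\<close>
    have "p e * (1 - p' e) \<le> p' e * (1 - p e)" using pe by (simp add: algebra_simps)
    then show "(if e \<in> w then p e else 1 - p e) * (if e \<in> w' then p' e else 1 - p' e)
        \<le> (if e \<in> w \<union> w' then p' e else 1 - p' e) * (if e \<in> w \<inter> w' then p e else 1 - p e)"
      by auto
    show "0 \<le> (if e \<in> w then p e else 1 - p e) * (if e \<in> w' then p' e else 1 - p' e)"
      using pe by auto
  qed
  moreover have "real (card (spin_sets V S w) * card (spin_sets V S' w'))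
      \<le> real (card (spin_sets V S' (w \<union> w')) * card (spin_sets V S (w \<inter> w')))"
    by (rule of_nat_mono[OF card_spin_sets_supermodular[OF fin(1) \<open>S \<subseteq> S'\<close>]])
  ultimately have "(edge_prod p E w * edge_prod p' E w') * real (card (spin_sets V S w) * card (spin_sets V S' w'))
     \<le> (edge_prod p' E (w \<union> w') * edge_prod p E (w \<inter> w'))
       * real (card (spin_sets V S' (w \<union> w')) * card (spin_sets V S (w \<inter> w')))"
    by (rule mult_mono) (auto intro!: mult_nonneg_nonneg edge_prod_nonneg p01)
  then have "wired_weight V S p E w * wired_weight V S' p' E w'
     \<le> wired_weight V S' p' E (w \<union> w') * wired_weight V S p E (w \<inter> w')"
    by (simp add: wired_weight_def mult_ac)
  moreover have "A w \<Longrightarrow> A (w \<union> w')" using incr[of w "w \<union> w'"] w by auto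
  moreover have "0 \<le> wired_weight V S' p' E (w \<union> w') * wired_weight V S p E (w \<inter> w')"
    using nonneg p01 by simp
  ultimately show "wired_weight V S p E w * of_bool (A w) * wired_weight V S' p' E w'
     \<le> wired_weight V S' p' E (w \<union> w') * of_bool (A (w \<union> w')) * wired_weight V S p E (w \<inter> w')"
    by (auto simp: of_bool_def)
qed

lemma finite_subgraph_edges:
  assumes "fin_conn_subgraph adj V E"
  shows "finite V" "finite E"
  using assms finite_subset[of E "Pow V"] by (auto simp: fin_conn_subgraph_def)

lemma sum_wired_weight_pos:
  assumes "finite V" "finite E" and "\<And>e. e \<in> E \<Longrightarrow> 0 \<le> p e \<and> p e \<le> 1"
  shows "(\<Sum>w\<in>Pow E. wired_weight V S p E w) > 0"
proof -
  have "{} \<in> spin_sets V S w" for w by (simp add: spin_sets_def)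
  then have "card (spin_sets V S w) > 0" for w
    using finite_spin_sets[OF assms(1)] card_gt_0_iff by blast
  then have "edge_prod p E w \<le> wired_weight V S p E w" for w
    unfolding wired_weight_def using edge_prod_nonneg[of E p w] assms(3)
    by (metis Suc_leI One_nat_def mult.right_neutral mult_left_mono of_nat_1 of_nat_mono)
  then have "(\<Sum>w\<in>Pow E. edge_prod p E w) \<le> (\<Sum>w\<in>Pow E. wired_weight V S p E w)"
    by (rule sum_mono)
  then show ?thesis using sum_edge_prod[OF assms(2), of p] by simp
qed

lemma fk_weight_eq_wired_weight:
  assumes "fin_conn_subgraph adj V E" "w \<subseteq> E"
  shows "fk_weight adj p V E w = wired_weight V (bdry adj V E) p E w"
proof -
  have "2 ^ ncomp_wired V (bdry adj V E) w = card (spin_sets V (bdry adj V E) w)"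
    by (rule two_power_ncomp_wired)
      (use assms in \<open>auto simp: fin_conn_subgraph_def bdry_def\<close>)
  then have "real (card (spin_sets V (bdry adj V E) w)) = 2 ^ ncomp_wired V (bdry adj V E) w"
    by (metis of_nat_numeral of_nat_power)
  then show ?thesis
    unfolding fk_weight_def wired_weight_def edge_prod_def by (simp add: mult.commute)
qed

lemma fk_prob_eq_wired_weight:
  assumes "fin_conn_subgraph adj V E"
  shows "fk_prob adj p V E A = (\<Sum>w\<in>Pow E. wired_weight V (bdry adj V E) p E w * of_bool (A w))
     / (\<Sum>w\<in>Pow E. wired_weight V (bdry adj V E) p E w)"
proof -
  have "(\<Sum>w\<in>{w. w \<subseteq> E \<and> A w}. fk_weight adj p V E w)
      = (\<Sum>w\<in>Pow E. wired_weight V (bdry adj V E) p E w * of_bool (A w))"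
    by (rule sum.mono_neutral_cong_left)
      (use finite_subgraph_edges(2)[OF assms] in \<open>auto simp: fk_weight_eq_wired_weight[OF assms]\<close>)
  moreover have "(\<Sum>w\<in>Pow E. fk_weight adj p V E w) = (\<Sum>w\<in>Pow E. wired_weight V (bdry adj V E) p E w)"
    by (intro sum.cong) (auto simp: fk_weight_eq_wired_weight[OF assms])
  ultimately show ?thesis by (simp add: fk_prob_def)
qed

lemma edge_eq_doubleton:
  assumes "e \<in> gedges adj"
  obtains a b where "e = {a, b}" "adj a b"
  using assms by (auto simp: gedges_def)

text \<open>Wiring \<open>V' - V\<close> together with the boundary of the smaller domain reduces
  the larger domain to the smaller one: an edge outside \<open>E\<close> has both ends in this wired
  set, so it imposes no constraint and its state sums out. The wired set contains the boundary of
  the larger domain, so domination gives the claim.\<close>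

theorem fk_prob_domain_mono:
  assumes D: "fin_conn_subgraph adj V E" and D': "fin_conn_subgraph adj V' E'"
    and sub: "V \<subseteq> V'" "E \<subseteq> E'" and ne: "bdry adj V E \<noteq> {}"
    and p: "\<And>e. e \<in> gedges adj \<Longrightarrow> 0 \<le> p e \<and> p e \<le> 1"
    and incr: "\<And>w w'. A w \<Longrightarrow> w \<subseteq> w' \<Longrightarrow> w' \<subseteq> E \<Longrightarrow> A w'"
  shows "fk_prob adj p V' E' (\<lambda>w. A (w \<inter> E)) \<le> fk_prob adj p V E A"
proof -
  let ?B = "bdry adj V E" and ?B' = "bdry adj V' E'"
  define S where "S = (V' - V) \<union> ?B"
  note fin = finite_subgraph_edges[OF D] finite_subgraph_edges[OF D']
  have p': "0 \<le> p e \<and> p e \<le> 1" if "e \<in> E'" for e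
    using p that D' by (auto simp: fin_conn_subgraph_def)
  have p'': "0 \<le> p e \<and> p e \<le> 1" if "e \<in> E" for e
    using p' that sub by auto
  have "?B' \<subseteq> S" using sub by (auto simp: S_def bdry_def)
  \<comment> \<open>A plus set of the smaller domain receives the outside vertices exactly when it
    contains the boundary; since the boundary is nonempty, it determines their common sign.\<close>
  have card_eq: "card (spin_sets V' S w) = card (spin_sets V ?B (w \<inter> E))" if w: "w \<subseteq> E'" for w
  proof (rule bij_betw_same_card[of "\<lambda>A. A \<inter> V"],
      rule bij_betwI[where g = "\<lambda>A. if ?B \<subseteq> A then A \<union> (V' - V) else A"])
    have BV: "?B \<subseteq> V" by (auto simp: bdry_def)
    have outside: "e \<subseteq> S" if "e \<in> w" "e \<notin> E" for e
      using that w D' unfolding S_def fin_conn_subgraph_def bdry_def by blast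
    have inside: "e \<subseteq> V" if "e \<in> E" for e
      using that D unfolding fin_conn_subgraph_def by blast
    show "(\<lambda>A. A \<inter> V) \<in> spin_sets V' S w \<rightarrow> spin_sets V ?B (w \<inter> E)"
      using BV inside unfolding spin_sets_def S_def by blast
    show "(\<lambda>A. if ?B \<subseteq> A then A \<union> (V' - V) else A) \<in> spin_sets V ?B (w \<inter> E) \<rightarrow> spin_sets V' S w"
    proof
      fix A assume A: "A \<in> spin_sets V ?B (w \<inter> E)"
      show "(if ?B \<subseteq> A then A \<union> (V' - V) else A) \<in> spin_sets V' S w"
      proof (cases "?B \<subseteq> A")
        case True
        have "b \<in> A \<union> (V' - V)" if e: "{a, b} \<in> w" "a \<in> A \<union> (V' - V)" for a b
        proof (cases "{a, b} \<in> E")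
          case True
          then show ?thesis using A e inside[OF True] by (auto simp: spin_sets_def)
        next
          case False
          then show ?thesis using outside[OF e(1)] \<open>?B \<subseteq> A\<close> by (auto simp: S_def)
        qed
        then show ?thesis using True A sub by (auto simp: spin_sets_def S_def)
      next
        case False
        then have dis: "S \<inter> A = {}" using A by (auto simp: spin_sets_def S_def)
        have "b \<in> A" if e: "{a, b} \<in> w" "a \<in> A" for a b
        proof (cases "{a, b} \<in> E")
          case True
          then show ?thesis using A e by (auto simp: spin_sets_def)
        next
          case False
          then show ?thesis using outside[OF e(1)] dis e(2) by auto
        qed
        then show ?thesis using False dis A sub by (auto simp: spin_sets_def)
      qed
    qed
    show "(if ?B \<subseteq> A \<inter> V then A \<inter> V \<union> (V' - V) else A \<inter> V) = A" if "A \<in> spin_sets V' S w" for A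
    proof -
      have "A \<subseteq> V'" "S \<subseteq> A \<or> S \<inter> A = {}" using that by (auto simp: spin_sets_def)
      then show ?thesis using BV ne by (cases "S \<subseteq> A") (auto simp: S_def)
    qed
    show "(if ?B \<subseteq> A then A \<union> (V' - V) else A) \<inter> V = A" if "A \<in> spin_sets V ?B (w \<inter> E)" for A
      using that by (auto simp: spin_sets_def)
  qed
  have "(\<Sum>w\<in>Pow E'. wired_weight V' S p E' w * of_bool (A (w \<inter> E)))
      = (\<Sum>w\<in>Pow E'. edge_prod p E' w * (card (spin_sets V ?B (w \<inter> E)) * of_bool (A (w \<inter> E))))"
    by (intro sum.cong) (auto simp: wired_weight_def card_eq)
  also have "\<dots> = (\<Sum>w\<in>Pow E. wired_weight V ?B p E w * of_bool (A w))"
    unfolding sum_edge_prod_restrict[OF fin(4) sub(2), where F = "\<lambda>w. card (spin_sets V ?B w) * of_bool (A w)"]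
    by (simp add: wired_weight_def mult_ac)
  finally have num: "(\<Sum>w\<in>Pow E'. wired_weight V' S p E' w * of_bool (A (w \<inter> E)))
      = (\<Sum>w\<in>Pow E. wired_weight V ?B p E w * of_bool (A w))" .
  have "(\<Sum>w\<in>Pow E'. wired_weight V' S p E' w)
      = (\<Sum>w\<in>Pow E'. edge_prod p E' w * real (card (spin_sets V ?B (w \<inter> E))))"
    by (intro sum.cong) (auto simp: wired_weight_def card_eq)
  also have "\<dots> = (\<Sum>w\<in>Pow E. wired_weight V ?B p E w)"
    unfolding sum_edge_prod_restrict[OF fin(4) sub(2), where F = "\<lambda>w. real (card (spin_sets V ?B w))"]
    by (simp add: wired_weight_def)
  finally have den: "(\<Sum>w\<in>Pow E'. wired_weight V' S p E' w) = (\<Sum>w\<in>Pow E. wired_weight V ?B p E w)" .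
  have "(\<Sum>w\<in>Pow E'. wired_weight V' ?B' p E' w * of_bool (A (w \<inter> E))) * (\<Sum>w\<in>Pow E'. wired_weight V' S p E' w)
    \<le> (\<Sum>w\<in>Pow E'. wired_weight V' S p E' w * of_bool (A (w \<inter> E))) * (\<Sum>w\<in>Pow E'. wired_weight V' ?B' p E' w)"
  proof (rule wired_weight_comparison[OF fin(3,4) \<open>?B' \<subseteq> S\<close>])
    show "A (w' \<inter> E)" if "A (w \<inter> E)" "w \<subseteq> w'" "w' \<subseteq> E'" for w w'
      using incr[OF that(1), of "w' \<inter> E"] that(2) by auto
  qed (use p' in auto)
  then show ?thesis
    unfolding fk_prob_eq_wired_weight[OF D] fk_prob_eq_wired_weight[OF D'] num den
    using sum_wired_weight_pos[OF fin(1,2), of p ?B] sum_wired_weight_pos[OF fin(3,4), of p ?B'] p' p''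
    by (simp add: divide_simps mult.commute)
qed

section \<open>Percolation to the boundary\<close>

definition bdry_conn :: "('v \<Rightarrow> 'v \<Rightarrow> bool) \<Rightarrow> 'v set \<Rightarrow> 'v set set \<Rightarrow> 'v \<Rightarrow> 'v set set \<Rightarrow> bool" where
  "bdry_conn adj V E v w \<longleftrightarrow> (\<exists>u\<in>bdry adj V E. (v, u) \<in> {(a, b). {a, b} \<in> w}\<^sup>*)"

lemma bdry_conn_mono:
  assumes "bdry_conn adj V E v w" "w \<subseteq> w'"
  shows "bdry_conn adj V E v w'"
proof -
  have "{(a, b). {a, b} \<in> w}\<^sup>* \<subseteq> {(a, b). {a, b} \<in> w'}\<^sup>*"
    using assms(2) by (intro rtrancl_mono) auto
  then show ?thesis using assms(1) by (auto simp: bdry_conn_def)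
qed

lemma bdryI:
  assumes "a \<in> V" "adj a b" "{a, b} \<notin> E"
  shows "a \<in> bdry adj V E"
  using assms by (auto simp: bdry_def gedges_def intro!: bexI[of _ "{a, b}"])

text \<open>The first edge of the path that is missing from \<open>E\<close> starts at a boundary
  vertex, and up to there the path is open inside \<open>E\<close>.\<close>

lemma path_leaves_through_bdry:
  assumes D: "fin_conn_subgraph adj V E" "v \<in> V"
    and path: "(v, u) \<in> {(a, b). adj a b \<and> \<omega> {a, b}}\<^sup>*"
  shows "bdry_conn adj V E v {e \<in> E. \<omega> e} \<or>
    u \<in> V \<and> (v, u) \<in> {(a, b). {a, b} \<in> {e \<in> E. \<omega> e}}\<^sup>*"
  using path
proof induction
  case base
  then show ?case using D by simp
next
  case (step a b)
  show ?case
  proof (cases "bdry_conn adj V E v {e \<in> E. \<omega> e}")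
    case False
    then have a: "a \<in> V" "(v, a) \<in> {(a, b). {a, b} \<in> {e \<in> E. \<omega> e}}\<^sup>*" using step by auto
    have "{a, b} \<in> E"
    proof (rule ccontr)
      assume "{a, b} \<notin> E"
      then have "a \<in> bdry adj V E" using bdryI[of a V adj b E] a step(2) by auto
      then show False using False a by (auto simp: bdry_conn_def)
    qed
    moreover have "b \<in> V" using \<open>{a, b} \<in> E\<close> D by (auto simp: fin_conn_subgraph_def)
    ultimately show ?thesis using a step(2) by (auto intro: rtrancl_into_rtrancl)
  qed simp
qed

lemma infinite_cluster_bdry_conn:
  assumes D: "fin_conn_subgraph adj V E" "v \<in> V"
    and inf: "infinite {u. (v, u) \<in> {(a, b). adj a b \<and> \<omega> {a, b}}\<^sup>*}"
  shows "bdry_conn adj V E v {e \<in> E. \<omega> e}"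
proof -
  have "\<not> {u. (v, u) \<in> {(a, b). adj a b \<and> \<omega> {a, b}}\<^sup>*} \<subseteq> V"
    using inf finite_subset finite_subgraph_edges(1)[OF D(1)] by blast
  then obtain u where "(v, u) \<in> {(a, b). adj a b \<and> \<omega> {a, b}}\<^sup>*" "u \<notin> V"
    by blast
  then show ?thesis using path_leaves_through_bdry[OF D] by blast
qed

lemma bdry_nonempty:
  assumes D: "fin_conn_subgraph adj V E"
    and "infinite (UNIV :: 'v set)" "graph_connected (adj :: 'v \<Rightarrow> 'v \<Rightarrow> bool)"
  shows "bdry adj V E \<noteq> {}"
proof -
  obtain v where "v \<in> V" using D by (auto simp: fin_conn_subgraph_def)
  moreover have "infinite {u. (v, u) \<in> {(a, b). adj a b \<and> True}\<^sup>*}"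
    using assms(2,3) by (simp add: graph_connected_def)
  ultimately have "bdry_conn adj V E v {e \<in> E. True}"
    by (intro infinite_cluster_bdry_conn[OF D, where \<omega> = "\<lambda>_. True"])
  then show ?thesis by (auto simp: bdry_conn_def)
qed

section \<open>Exhaustion by graph balls\<close>

primrec gball :: "('v \<Rightarrow> 'v \<Rightarrow> bool) \<Rightarrow> 'v \<Rightarrow> nat \<Rightarrow> 'v set" where
  "gball adj r 0 = {r}"
| "gball adj r (Suc n) = gball adj r n \<union> (\<Union>u\<in>gball adj r n. {w. adj u w})"

definition induced_edges :: "('v \<Rightarrow> 'v \<Rightarrow> bool) \<Rightarrow> 'v set \<Rightarrow> 'v set set" where
  "induced_edges adj V = {e \<in> gedges adj. e \<subseteq> V}"

text \<open>\<open>wired_FK_limit\<close> quantifies over exhausting sequences, so it yields a limit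
  only once such a sequence is produced. Local finiteness makes the balls finite, and connectedness
  makes them cover the graph.\<close>

lemma exhausting_exists:
  fixes adj :: "'v \<Rightarrow> 'v \<Rightarrow> bool"
  assumes "locally_finite adj" "graph_connected adj"
  obtains Vs Es where "exhausting adj Vs Es"
proof -
  fix r :: 'v
  let ?B = "gball adj r"
  have fin: "finite (?B n)" for n
    by (induction n) (use assms(1) in \<open>auto simp: locally_finite_def\<close>)
  have mono: "incseq ?B" by (rule incseq_SucI) auto
  have mono': "induced_edges adj (?B m) \<subseteq> induced_edges adj (?B n)" if "m \<le> n" for m n
    using incseqD[OF mono that] by (auto simp: induced_edges_def)
  have root_conn: "(r, w) \<in> {(a, b). {a, b} \<in> induced_edges adj (?B n)}\<^sup>*" if "w \<in> ?B n" for n w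
    using that
  proof (induction n arbitrary: w)
    case (Suc n)
    have "{(a, b). {a, b} \<in> induced_edges adj (?B n)} \<subseteq> {(a, b). {a, b} \<in> induced_edges adj (?B (Suc n))}"
      using mono'[of n "Suc n"] by auto
    from rtrancl_mono[OF this]
    have up: "(r, u) \<in> {(a, b). {a, b} \<in> induced_edges adj (?B (Suc n))}\<^sup>*" if "u \<in> ?B n" for u
      using Suc.IH[OF that] by auto
    from Suc.prems consider "w \<in> ?B n" | u where "u \<in> ?B n" "adj u w" by auto
    then show ?case
    proof cases
      case 2
      then have "{u, w} \<in> induced_edges adj (?B (Suc n))"
        by (auto simp: induced_edges_def gedges_def)
      then show ?thesis using up[OF 2(1)] by (auto intro: rtrancl_into_rtrancl)
    qed (rule up)
  qed simp
  have sub: "fin_conn_subgraph adj (?B n) (induced_edges adj (?B n))" for n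
  proof -
    let ?R = "{(a, b). {a, b} \<in> induced_edges adj (?B n)}"
    have "sym (?R\<^sup>*)" by (intro sym_rtrancl) (auto simp: sym_def insert_commute)
    then have "(v, w) \<in> ?R\<^sup>*" if "v \<in> ?B n" "w \<in> ?B n" for v w
      using root_conn[OF that(1)] root_conn[OF that(2)] by (meson rtrancl_trans symD)
    moreover have "?B n \<noteq> {}" by (induction n) auto
    ultimately show ?thesis using fin by (auto simp: fin_conn_subgraph_def induced_edges_def)
  qed
  have cover: "\<exists>n. v \<in> ?B n" for v
  proof -
    have "(r, v) \<in> {(a, b). adj a b}\<^sup>*" using assms(2) by (simp add: graph_connected_def)
    then show ?thesis
    proof induction
      case base
      show ?case by (rule exI[of _ 0]) simp
    next
      case (step a b)
      then obtain n where "a \<in> ?B n" by auto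
      then show ?case using step(2) by (intro exI[of _ "Suc n"]) auto
    qed
  qed
  have "e \<in> (\<Union>n. induced_edges adj (?B n))" if e: "e \<in> gedges adj" for e
  proof -
    obtain a b where ab: "e = {a, b}" "adj a b" by (rule edge_eq_doubleton[OF e])
    obtain n where "a \<in> ?B n" using cover by blast
    then have "a \<in> ?B (Suc n)" "b \<in> ?B (Suc n)" using ab by auto
    then have "e \<in> induced_edges adj (?B (Suc n))" using e ab(1) unfolding induced_edges_def by auto
    then show ?thesis by blast
  qed
  then have edges: "(\<Union>n. induced_edges adj (?B n)) = gedges adj"
    by (auto simp: induced_edges_def)
  have "exhausting adj ?B (\<lambda>n. induced_edges adj (?B n))"
    unfolding exhausting_def using sub mono mono' cover edges by (auto simp: incseq_def)
  then show ?thesis by (rule that)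
qed

lemma eventually_mem_incseq:
  assumes "incseq X" "x \<in> (\<Union>n. X n)"
  shows "eventually (\<lambda>n. x \<in> X n) sequentially"
proof -
  obtain N where "x \<in> X N" using assms(2) by auto
  then show ?thesis using incseqD[OF assms(1), of N] by (intro eventually_sequentiallyI[of N]) auto
qed

lemma exhausting_eventually_contains:
  assumes ex: "exhausting adj Vs Es" and D: "fin_conn_subgraph adj V E"
  shows "eventually (\<lambda>n. V \<subseteq> Vs n \<and> E \<subseteq> Es n) sequentially"
proof -
  have "eventually (\<lambda>n. \<forall>v\<in>V. v \<in> Vs n) sequentially"
    using finite_subgraph_edges[OF D] ex eventually_mem_incseq[of Vs]
    by (intro eventually_ball_finite) (auto simp: exhausting_def)
  moreover have "eventually (\<lambda>n. \<forall>e\<in>E. e \<in> Es n) sequentially"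
    using finite_subgraph_edges[OF D] ex D eventually_mem_incseq[of Es]
    by (intro eventually_ball_finite) (auto simp: exhausting_def fin_conn_subgraph_def)
  ultimately show ?thesis by eventually_elim auto
qed

section \<open>Events on finitely many edges and the infinite-volume limit\<close>

lemma cylinder_measurable:
  assumes "finite F" "F \<subseteq> gedges adj"
  shows "{\<omega> \<in> space (config_space adj). \<forall>e\<in>F. \<omega> e \<longleftrightarrow> e \<in> \<eta>} \<in> sets (config_space adj)"
proof (rule sets.sets_Collect_finite_All[OF _ assms(1)])
  fix e assume e: "e \<in> F"
  then have "(\<lambda>\<omega>. \<omega> e) \<in> measurable (config_space adj) (count_space UNIV)"
    unfolding config_space_def using assms(2) by (intro measurable_component_singleton) auto
  from measurable_sets[OF this, of "{e \<in> \<eta>}"]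
  show "{\<omega> \<in> space (config_space adj). \<omega> e \<longleftrightarrow> e \<in> \<eta>} \<in> sets (config_space adj)"
    by (simp add: vimage_def Int_def conj_commute)
qed

lemma finite_event_measurable:
  assumes "finite F" "F \<subseteq> gedges adj"
  shows "{\<omega> \<in> space (config_space adj). A {e \<in> F. \<omega> e}} \<in> sets (config_space adj)"
    and "\<lbrakk>prob_space \<mu>; sets \<mu> = sets (config_space adj)\<rbrakk> \<Longrightarrow>
      measure \<mu> {\<omega> \<in> space (config_space adj). A {e \<in> F. \<omega> e}} =
      (\<Sum>\<eta>\<in>{\<eta> \<in> Pow F. A \<eta>}. measure \<mu> {\<omega> \<in> space (config_space adj). \<forall>e\<in>F. \<omega> e \<longleftrightarrow> e \<in> \<eta>})"
proof -
  let ?cyl = "\<lambda>\<eta>. {\<omega> \<in> space (config_space adj). \<forall>e\<in>F. \<omega> e \<longleftrightarrow> e \<in> \<eta>}"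
  have eq: "{\<omega> \<in> space (config_space adj). A {e \<in> F. \<omega> e}} = (\<Union>\<eta>\<in>{\<eta> \<in> Pow F. A \<eta>}. ?cyl \<eta>)"
  proof (intro equalityI subsetI)
    fix \<omega> assume "\<omega> \<in> {\<omega> \<in> space (config_space adj). A {e \<in> F. \<omega> e}}"
    then show "\<omega> \<in> (\<Union>\<eta>\<in>{\<eta> \<in> Pow F. A \<eta>}. ?cyl \<eta>)"
      by (intro UN_I[of "{e \<in> F. \<omega> e}"]) auto
  next
    fix \<omega> assume "\<omega> \<in> (\<Union>\<eta>\<in>{\<eta> \<in> Pow F. A \<eta>}. ?cyl \<eta>)"
    then obtain \<eta> where \<eta>: "\<eta> \<subseteq> F" "A \<eta>" "\<omega> \<in> ?cyl \<eta>" by auto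
    then have "{e \<in> F. \<omega> e} = \<eta>" by auto
    then show "\<omega> \<in> {\<omega> \<in> space (config_space adj). A {e \<in> F. \<omega> e}}" using \<eta> by auto
  qed
  have fin: "finite {\<eta> \<in> Pow F. A \<eta>}" using assms(1) by auto
  show "{\<omega> \<in> space (config_space adj). A {e \<in> F. \<omega> e}} \<in> sets (config_space adj)"
    unfolding eq using fin cylinder_measurable[OF assms] by (intro sets.finite_UN) auto
  assume "prob_space \<mu>" and sets: "sets \<mu> = sets (config_space adj)"
  then interpret prob_space \<mu> by simp
  have disj: "disjoint_family_on ?cyl {\<eta> \<in> Pow F. A \<eta>}"
  proof (unfold disjoint_family_on_def, intro ballI impI)
    fix \<eta> \<eta>' assume *: "\<eta> \<in> {\<eta> \<in> Pow F. A \<eta>}" "\<eta>' \<in> {\<eta> \<in> Pow F. A \<eta>}" "\<eta> \<noteq> \<eta>'"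
    then obtain e where "e \<in> F" "e \<in> \<eta> \<longleftrightarrow> e \<notin> \<eta>'" by blast
    then show "?cyl \<eta> \<inter> ?cyl \<eta>' = {}" by auto
  qed
  have "?cyl ` {\<eta> \<in> Pow F. A \<eta>} \<subseteq> sets \<mu>"
    using cylinder_measurable[OF assms] sets by auto
  then show "measure \<mu> {\<omega> \<in> space (config_space adj). A {e \<in> F. \<omega> e}} = (\<Sum>\<eta>\<in>{\<eta> \<in> Pow F. A \<eta>}. measure \<mu> (?cyl \<eta>))"
    unfolding eq by (rule finite_measure_finite_Union[OF fin _ disj])
qed

lemma fk_prob_sum_cylinders:
  assumes "fin_conn_subgraph adj V E" "finite F"
  shows "fk_prob adj p V E (\<lambda>w. A (w \<inter> F)) = (\<Sum>\<eta>\<in>{\<eta> \<in> Pow F. A \<eta>}. fk_prob adj p V E (\<lambda>w. w \<inter> F = \<eta>))"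
proof -
  let ?W = "wired_weight V (bdry adj V E) p E"
  have "of_bool (A (w \<inter> F)) = (\<Sum>\<eta>\<in>{\<eta> \<in> Pow F. A \<eta>}. of_bool (w \<inter> F = \<eta>) :: real)" for w
    using assms(2) by (simp add: of_bool_def)
  then have "(\<Sum>w\<in>Pow E. ?W w * of_bool (A (w \<inter> F)))
      = (\<Sum>w\<in>Pow E. \<Sum>\<eta>\<in>{\<eta> \<in> Pow F. A \<eta>}. ?W w * of_bool (w \<inter> F = \<eta>))"
    by (simp only: sum_distrib_left)
  also have "\<dots> = (\<Sum>\<eta>\<in>{\<eta> \<in> Pow F. A \<eta>}. \<Sum>w\<in>Pow E. ?W w * of_bool (w \<inter> F = \<eta>))"
    by (rule sum.swap)
  finally show ?thesis
    unfolding fk_prob_eq_wired_weight[OF assms(1)] by (simp only: sum_divide_distrib)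
qed

text \<open>An event on finitely many edges is a finite union of cylinders, so its probabilities
  converge along an exhaustion. Once the domains contain \<open>V\<close> and \<open>E\<close>,
  these probabilities lie below the one on \<open>(V, E)\<close>, hence so does the limit.\<close>

lemma wired_FK_limit_le_fk_prob:
  fixes adj :: "'v \<Rightarrow> 'v \<Rightarrow> bool"
  assumes lim: "wired_FK_limit adj p \<mu>" and D: "fin_conn_subgraph adj V E"
    and G: "infinite (UNIV :: 'v set)" "locally_finite adj" "graph_connected adj"
    and p: "\<And>e. e \<in> gedges adj \<Longrightarrow> 0 \<le> p e \<and> p e \<le> 1"
    and incr: "\<And>w w'. A w \<Longrightarrow> w \<subseteq> w' \<Longrightarrow> w' \<subseteq> E \<Longrightarrow> A w'"
  shows "measure \<mu> {\<omega> \<in> space (config_space adj). A {e \<in> E. \<omega> e}} \<le> fk_prob adj p V E A"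
proof -
  obtain Vs Es where ex: "exhausting adj Vs Es" using exhausting_exists[OF G(2,3)] .
  have E: "finite E" "E \<subseteq> gedges adj"
    using finite_subgraph_edges[OF D] D by (auto simp: fin_conn_subgraph_def)
  have sub: "fin_conn_subgraph adj (Vs n) (Es n)" for n using ex by (simp add: exhausting_def)
  have \<mu>: "prob_space \<mu>" "sets \<mu> = sets (config_space adj)" using lim by (auto simp: wired_FK_limit_def)
  have "(\<lambda>n. fk_prob adj p (Vs n) (Es n) (\<lambda>w. A (w \<inter> E)))
      \<longlonglongrightarrow> measure \<mu> {\<omega> \<in> space (config_space adj). A {e \<in> E. \<omega> e}}"
    unfolding fk_prob_sum_cylinders[OF sub E(1)] finite_event_measurable(2)[OF E \<mu>]
    using lim ex E by (intro tendsto_sum) (auto simp: wired_FK_limit_def)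
  then show ?thesis
  proof (rule tendsto_upperbound)
    show "\<forall>\<^sub>F n in sequentially. fk_prob adj p (Vs n) (Es n) (\<lambda>w. A (w \<inter> E)) \<le> fk_prob adj p V E A"
      using exhausting_eventually_contains[OF ex D]
    proof eventually_elim
      case (elim n)
      show ?case
        by (rule fk_prob_domain_mono[OF D sub]) (use elim bdry_nonempty[OF D G(1,3)] p incr in auto)
    qed
  qed simp
qed

text \<open>An infinite cluster at \<open>v\<close> connects \<open>v\<close> to the boundary of
  every domain around it. If this had probability 0 for each of the countably many \<open>v\<close>,
  percolation would have probability 0; so it is positive for some \<open>v\<close>, and that value
  is \<open>\<theta>\<close>.\<close>

theorem uniform_bdry_conn:
  fixes adj :: "'v \<Rightarrow> 'v \<Rightarrow> bool"
  assumes lim: "wired_FK_limit adj p \<mu>" and perc: "AE \<omega> in \<mu>. has_inf_cluster adj \<omega>"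
    and G: "countable (UNIV :: 'v set)" "infinite (UNIV :: 'v set)" "locally_finite adj" "graph_connected adj"
    and p: "\<And>e. e \<in> gedges adj \<Longrightarrow> 0 \<le> p e \<and> p e \<le> 1"
  obtains v \<theta> where "\<theta> > 0"
    "\<And>V E. fin_conn_subgraph adj V E \<Longrightarrow> v \<in> V \<Longrightarrow> \<theta> \<le> fk_prob adj p V E (bdry_conn adj V E v)"
proof -
  interpret prob_space \<mu> using lim by (simp add: wired_FK_limit_def)
  have sets: "sets \<mu> = sets (config_space adj)" using lim by (simp add: wired_FK_limit_def)
  then have space: "space \<mu> = space (config_space adj)" by (rule sets_eq_imp_space_eq)
  define D where "D v = {(V, E). fin_conn_subgraph adj V E \<and> v \<in> V}" for v
  \<comment> \<open>A stand-in for the event that \<open>v\<close> has an infinite cluster: it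
    contains that event, is a countable intersection of events on finitely many edges, hence
    measurable, and lies inside each finite-domain event.\<close>
  define B where "B v = {\<omega> \<in> space (config_space adj). \<forall>(V, E)\<in>D v. bdry_conn adj V E v {e \<in> E. \<omega> e}}" for v
  have D_count: "countable (D v)" for v
  proof (rule countable_subset)
    show "D v \<subseteq> {V. finite V \<and> V \<subseteq> UNIV} \<times> {E. finite E \<and> E \<subseteq> {V. finite V \<and> V \<subseteq> UNIV}}"
    proof
      fix x assume "x \<in> D v"
      then obtain V E where x: "x = (V, E)" "fin_conn_subgraph adj V E" by (auto simp: D_def)
      moreover have "finite e" if "e \<in> E" for e
        using that x(2) finite_subset[of e V] by (auto simp: fin_conn_subgraph_def)
      ultimately show "x \<in> {V. finite V \<and> V \<subseteq> UNIV} \<times> {E. finite E \<and> E \<subseteq> {V. finite V \<and> V \<subseteq> UNIV}}"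
        using finite_subgraph_edges[OF x(2)] by auto
    qed
    show "countable ({V :: 'v set. finite V \<and> V \<subseteq> UNIV} \<times> {E. finite E \<and> E \<subseteq> {V :: 'v set. finite V \<and> V \<subseteq> UNIV}})"
      by (intro countable_SIGMA countable_Collect_finite_subset G(1))
  qed
  have event: "{\<omega> \<in> space (config_space adj). bdry_conn adj V E v {e \<in> E. \<omega> e}} \<in> sets (config_space adj)"
    if "fin_conn_subgraph adj V E" for V E v
    using finite_event_measurable(1)[of E adj "bdry_conn adj V E v"] that finite_subgraph_edges[OF that]
    by (auto simp: fin_conn_subgraph_def)
  have B_meas: "B v \<in> sets \<mu>" for v
    unfolding sets B_def
    by (rule sets.sets_Collect_countable_All'[OF _ D_count]) (use event in \<open>auto simp: D_def\<close>)
  have "\<exists>v. measure \<mu> (B v) > 0"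
  proof (rule ccontr)
    assume "\<not> ?thesis"
    then have zero: "measure \<mu> (B v) = 0" for v
      by (metis measure_nonneg not_less order_antisym)
    have "AE \<omega> in \<mu>. \<omega> \<notin> B v" for v
      using zero[of v] B_meas[of v] by (intro AE_not_in) (auto simp: null_sets_def emeasure_eq_measure)
    then have "AE \<omega> in \<mu>. \<forall>v\<in>UNIV. \<omega> \<notin> B v"
      by (intro AE_ball_countable'[OF _ G(1)])
    then have "AE \<omega> in \<mu>. False"
      using perc AE_space
    proof eventually_elim
      case (elim \<omega>)
      then obtain v where "infinite {w. (v, w) \<in> {(a, b). adj a b \<and> \<omega> {a, b}}\<^sup>*}"
        by (auto simp: has_inf_cluster_def)
      then have "\<omega> \<in> B v"
        using elim(3) infinite_cluster_bdry_conn[of adj _ _ v \<omega>] by (auto simp: B_def D_def space)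
      then show ?case using elim(1) by auto
    qed
    then show False by simp
  qed
  then obtain v where v: "measure \<mu> (B v) > 0" by blast
  show ?thesis
  proof (rule that[OF v])
    fix V E assume VE: "fin_conn_subgraph adj V E" "v \<in> V"
    have "measure \<mu> (B v) \<le> measure \<mu> {\<omega> \<in> space (config_space adj). bdry_conn adj V E v {e \<in> E. \<omega> e}}"
      by (rule finite_measure_mono) (use VE event[OF VE(1), of v] sets in \<open>auto simp: B_def D_def\<close>)
    also have "\<dots> \<le> fk_prob adj p V E (bdry_conn adj V E v)"
      by (rule wired_FK_limit_le_fk_prob[OF lim VE(1) G(2-4) p bdry_conn_mono])
    finally show "measure \<mu> (B v) \<le> fk_prob adj p V E (bdry_conn adj V E v)" .
  qed
qed

section \<open>Signs of the height function\<close>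

definition plus_sets :: "'v set \<Rightarrow> 'v set \<Rightarrow> 'v set set \<Rightarrow> 'v set set" where
  "plus_sets V S w = {P \<in> spin_sets V S w. S \<subseteq> P}"

text \<open>Complementation in \<open>V\<close> exchanges the spin sets that contain
  \<open>S\<close> with those that miss it; as \<open>S\<close> is nonempty, no set does
  both.\<close>

lemma card_plus_sets:
  assumes "finite V" "S \<subseteq> V" "S \<noteq> {}" "\<forall>e\<in>w. e \<subseteq> V"
  shows "card (spin_sets V S w) = 2 * card (plus_sets V S w)"
proof -
  have compl: "V - P \<in> spin_sets V S w" if P: "P \<in> spin_sets V S w" for P
  proof -
    have "b \<in> V - P" if "{a, b} \<in> w" "a \<in> V - P" for a b
      using spin_sets_edge[OF P that(1)] that assms(4) by auto
    moreover have "S \<subseteq> V - P \<or> S \<inter> (V - P) = {}" using P assms(2) by (auto simp: spin_sets_def)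
    ultimately show ?thesis by (simp add: spin_sets_def)
  qed
  have "bij_betw (\<lambda>P. V - P) (plus_sets V S w) (spin_sets V S w - plus_sets V S w)"
  proof (rule bij_betwI[where g = "\<lambda>P. V - P"])
    show "(\<lambda>P. V - P) \<in> plus_sets V S w \<rightarrow> spin_sets V S w - plus_sets V S w"
      using compl assms(3) by (auto simp: plus_sets_def)
    have "S \<subseteq> V - P" if "P \<in> spin_sets V S w" "\<not> S \<subseteq> P" for P
      using that assms(2) by (auto simp: spin_sets_def)
    then show "(\<lambda>P. V - P) \<in> spin_sets V S w - plus_sets V S w \<rightarrow> plus_sets V S w"
      using compl by (auto simp: plus_sets_def)
  qed (auto simp: plus_sets_def spin_sets_def)
  then have "card (plus_sets V S w) = card (spin_sets V S w - plus_sets V S w)"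
    by (rule bij_betw_same_card)
  moreover have "plus_sets V S w \<subseteq> spin_sets V S w" by (auto simp: plus_sets_def)
  ultimately show ?thesis
    using finite_spin_sets[OF assms(1), of S w] card_Diff_subset[of "plus_sets V S w" "spin_sets V S w"]
      card_mono[of "spin_sets V S w" "plus_sets V S w"] finite_subset by fastforce
qed

text \<open>Flipping the cluster of \<open>v\<close> is a sign-reversing involution unless it meets \<open>S\<close>.\<close>

lemma sum_sign_plus_sets:
  assumes "v \<in> V" "\<forall>e\<in>w. e \<subseteq> V"
  shows "(\<Sum>P\<in>plus_sets V S w. if v \<in> P then 1 else -1 :: real)
    = (if \<exists>u\<in>S. (v, u) \<in> {(a, b). {a, b} \<in> w}\<^sup>* then card (plus_sets V S w) else 0)"
proof (cases "\<exists>u\<in>S. (v, u) \<in> {(a, b). {a, b} \<in> w}\<^sup>*")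
  case True
  then obtain u where u: "u \<in> S" "(v, u) \<in> {(a, b). {a, b} \<in> w}\<^sup>*" by blast
  have "v \<in> P" if P: "P \<in> plus_sets V S w" for P
  proof -
    have "P \<in> spin_sets V S w" "u \<in> P" using P u by (auto simp: plus_sets_def)
    moreover have "(u, v) \<in> {(a, b). {a, b} \<in> w}\<^sup>*"
    proof (rule symD[OF sym_rtrancl u(2)])
      show "sym {(a, b). {a, b} \<in> w}" by (auto simp: sym_def insert_commute)
    qed
    then have "(u, v) \<in> ({(a, b). {a, b} \<in> w} \<union> S \<times> S)\<^sup>*"
      using rtrancl_mono[of "{(a, b). {a, b} \<in> w}"] by blast
    ultimately show ?thesis by (rule spin_sets_rtrancl)
  qed
  then show ?thesis using True by simp
next
  case False
  define C where "C = {u. (v, u) \<in> {(a, b). {a, b} \<in> w}\<^sup>*}"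
  have C_step: "b \<in> C" if "a \<in> C" "{a, b} \<in> w" for a b
    using that by (auto simp: C_def intro: rtrancl_into_rtrancl)
  have C_edge: "a \<in> C \<longleftrightarrow> b \<in> C" if "{a, b} \<in> w" for a b
    using C_step[of a b] C_step[of b a] that by (auto simp: insert_commute)
  have "u \<in> V" if "(v, u) \<in> {(a, b). {a, b} \<in> w}\<^sup>*" for u
    using that by induction (use assms in auto)
  then have C: "C \<subseteq> V" "v \<in> C" "S \<inter> C = {}" using False by (auto simp: C_def)
  let ?flip = "\<lambda>P. (P - C) \<union> (C - P)"
  have flip: "?flip P \<in> plus_sets V S w" if P: "P \<in> plus_sets V S w" for P
  proof -
    have P': "P \<in> spin_sets V S w" "S \<subseteq> P" "P \<subseteq> V" using P by (auto simp: plus_sets_def spin_sets_def)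
    have "b \<in> ?flip P" if "{a, b} \<in> w" "a \<in> ?flip P" for a b
      using that spin_sets_edge[OF P'(1) that(1)] C_edge[OF that(1)] by auto
    moreover have "S \<subseteq> ?flip P" "?flip P \<subseteq> V" using P' C by auto
    ultimately show ?thesis unfolding plus_sets_def spin_sets_def by simp
  qed
  have bij: "bij_betw ?flip (plus_sets V S w) (plus_sets V S w)"
    by (rule bij_betwI[where g = ?flip]) (use flip in auto)
  have "(\<Sum>P\<in>plus_sets V S w. if v \<in> P then 1 else -1 :: real)
      = (\<Sum>P\<in>plus_sets V S w. if v \<in> ?flip P then 1 else -1)"
    using sum.reindex_bij_betw[OF bij, of "\<lambda>P. if v \<in> P then 1 else -1 :: real"] by simp
  also have "\<dots> = (\<Sum>P\<in>plus_sets V S w. - (if v \<in> P then 1 else -1))"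
    by (intro sum.cong) (use C in auto)
  also have "\<dots> = - (\<Sum>P\<in>plus_sets V S w. if v \<in> P then 1 else -1)" by (rule sum_negf)
  finally show ?thesis using False by simp
qed

section \<open>Height functions on a fixed domain\<close>

locale height_domain =
  fixes adj :: "'v \<Rightarrow> 'v \<Rightarrow> bool" and c :: "'v set \<Rightarrow> real" and V :: "'v set" and E :: "'v set set"
  assumes subgraph: "fin_conn_subgraph adj V E"
    and bdry_ne: "bdry adj V E \<noteq> {}"
    and c_ge_1: "\<And>e. e \<in> E \<Longrightarrow> c e \<ge> 1"
begin

abbreviation "B \<equiv> bdry adj V E"
abbreviation "H \<equiv> heights1 adj V E"
abbreviation "W \<equiv> hweight c E"

lemma finite_V: "finite V" and finite_E: "finite E"
  using finite_subgraph_edges[OF subgraph] by auto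

lemma edge_cases:
  assumes "e \<in> E"
  obtains a b where "e = {a, b}" "a \<in> V" "b \<in> V"
proof -
  have "e \<in> gedges adj" "e \<subseteq> V" using assms subgraph by (auto simp: fin_conn_subgraph_def)
  then show ?thesis using that by (auto elim!: edge_eq_doubleton)
qed

lemma B_subset_V: "B \<subseteq> V"
  by (auto simp: bdry_def)

lemma heightsD:
  assumes "h \<in> H"
  shows "odd (h u)" "u \<notin> V \<Longrightarrow> h u = 1" "u \<in> B \<Longrightarrow> h u = 1" "{a, b} \<in> E \<Longrightarrow> \<bar>h a - h b\<bar> \<le> 2"
proof -
  show "odd (h u)" using assms by (cases "u \<in> V") (auto simp: heights1_def)
qed (use assms in \<open>auto simp: heights1_def\<close>)

lemma heightsI:
  assumes "\<And>u. u \<in> V \<Longrightarrow> odd (h u)" "\<And>u. u \<notin> V \<Longrightarrow> h u = 1" "\<And>u. u \<in> B \<Longrightarrow> h u = 1"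
    and "\<And>a b. {a, b} \<in> E \<Longrightarrow> \<bar>h a - h b\<bar> \<le> 2"
  shows "h \<in> H"
proof -
  have "\<bar>h a - h b\<bar> \<le> 2" if e: "e \<in> E" "a \<in> e" "b \<in> e" for e a b
  proof -
    obtain x y where "e = {x, y}" using edge_cases[OF e(1)] by blast
    then show ?thesis using e assms(4)[of x y] by (auto simp: abs_minus_commute)
  qed
  then show ?thesis using assms(1-3) by (auto simp: heights1_def)
qed

text \<open>A boundary vertex \<open>r\<close> pins the height to 1, and each edge on a path from
  \<open>r\<close> changes it by at most 2. Without such an anchor \<open>H\<close> would be
  invariant under shifts by 2 on \<open>V\<close>.\<close>

lemma heights_bounded: "\<exists>M. \<forall>h\<in>H. \<forall>u. \<bar>h u\<bar> \<le> M"
proof -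
  obtain r where r: "r \<in> B" using bdry_ne by auto
  have "\<exists>n. \<forall>h\<in>H. \<bar>h u\<bar> \<le> n" if "u \<in> V" for u
  proof -
    have "(r, u) \<in> {(a, b). {a, b} \<in> E}\<^sup>*"
      using subgraph that r B_subset_V by (auto simp: fin_conn_subgraph_def)
    then show ?thesis
    proof induction
      case base
      show ?case by (intro exI[of _ 1]) (auto simp: heightsD(3)[OF _ r])
    next
      case (step a b)
      then obtain n where n: "\<forall>h\<in>H. \<bar>h a\<bar> \<le> n" by auto
      have "\<bar>h b\<bar> \<le> n + 2" if "h \<in> H" for h
        using heightsD(4)[OF that, of a b] step(2) n that by fastforce
      then show ?case by auto
    qed
  qed
  then obtain n where n: "\<And>u h. u \<in> V \<Longrightarrow> h \<in> H \<Longrightarrow> \<bar>h u\<bar> \<le> n u" by metis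
  have "\<bar>h u\<bar> \<le> 1 + (\<Sum>u\<in>V. \<bar>n u\<bar>)" if "h \<in> H" for h u
  proof (cases "u \<in> V")
    case True
    then have "\<bar>n u\<bar> \<le> (\<Sum>u\<in>V. \<bar>n u\<bar>)" by (intro member_le_sum finite_V) auto
    then show ?thesis using n[OF True that] by linarith
  next
    case False
    then show ?thesis using heightsD(2)[OF that] by (simp add: sum_nonneg)
  qed
  then show ?thesis by blast
qed

lemma heights_subset_box: "(\<And>h u. h \<in> H \<Longrightarrow> h u \<in> L) \<Longrightarrow> H \<subseteq> box_funs V L 1"
  using heightsD(2) by (auto simp: box_funs_def)

lemma finite_H: "finite H"
proof -
  obtain M where M: "\<forall>h\<in>H. \<forall>u. \<bar>h u\<bar> \<le> M" using heights_bounded by blast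
  then have "h u \<in> {-M..M}" if "h \<in> H" for h u using that by (auto simp: abs_le_iff minus_le_iff)
  then have "H \<subseteq> box_funs V {-M..M} 1" by (rule heights_subset_box)
  then show ?thesis using finite_box_funs[OF finite_V, of "{-M..M}"] finite_subset by auto
qed

lemma W_pos: "W h > 0"
  unfolding hweight_def using c_ge_1 by (intro prod_pos) (force simp: less_le_trans[OF zero_less_one])

lemma one_in_H: "(\<lambda>_. 1) \<in> H"
  by (rule heightsI) auto

lemma partition_pos: "(\<Sum>h\<in>H. W h) > 0"
  using finite_H one_in_H W_pos by (intro sum_pos) auto

text \<open>Given \<open>|h| = g\<close>, the sign of \<open>h\<close> is an Ising model whose FK representation has parameter
  \<open>1 - 1 / c e\<close> where \<open>g\<close> equals \<open>1\<close> on both ends of \<open>e\<close>, and \<open>1\<close> on the remaining edges.\<close>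

definition abs_param :: "('v \<Rightarrow> int) \<Rightarrow> 'v set \<Rightarrow> real" where
  "abs_param g e = (if \<forall>a\<in>e. g a = 1 then 1 - 1 / c e else 1)"

definition signed :: "('v \<Rightarrow> int) \<Rightarrow> 'v set \<Rightarrow> 'v \<Rightarrow> int" where
  "signed g P u = (if u \<in> V - P then - g u else g u)"

text \<open>Odd heights are never zero, so \<open>h\<close> is recovered from \<open>|h|\<close> and
  the set where it is positive, which contains the boundary.\<close>

lemma bij_betw_signed:
  assumes "g \<in> (\<lambda>h u. \<bar>h u\<bar>) ` H"
  shows "bij_betw (signed g) {P. P \<subseteq> V \<and> B \<subseteq> P \<and> signed g P \<in> H} {h \<in> H. (\<lambda>u. \<bar>h u\<bar>) = g}"
proof (rule bij_betwI[where g = "\<lambda>h. {u \<in> V. h u > 0}"])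
  obtain h0 where h0: "h0 \<in> H" "g = (\<lambda>u. \<bar>h0 u\<bar>)" using assms by auto
  then have g_pos: "g u > 0" for u using heightsD(1)[OF h0(1), of u] by (cases "h0 u = 0") auto
  have "\<bar>signed g P u\<bar> = g u" for P u using g_pos[of u] by (auto simp: signed_def)
  then show "signed g \<in> {P. P \<subseteq> V \<and> B \<subseteq> P \<and> signed g P \<in> H} \<rightarrow> {h \<in> H. (\<lambda>u. \<bar>h u\<bar>) = g}"
    by auto
  have inv: "signed g {u \<in> V. h u > 0} = h" if "h \<in> H" "(\<lambda>u. \<bar>h u\<bar>) = g" for h
  proof
    fix u
    have "g u = \<bar>h u\<bar>" using that(2) by auto
    then show "signed g {u \<in> V. h u > 0} u = h u"
      using heightsD(2)[OF that(1), of u] by (auto simp: signed_def)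
  qed
  then show "signed g {u \<in> V. h u > 0} = h" if "h \<in> {h \<in> H. (\<lambda>u. \<bar>h u\<bar>) = g}" for h
    using that by auto
  show "(\<lambda>h. {u \<in> V. h u > 0}) \<in> {h \<in> H. (\<lambda>u. \<bar>h u\<bar>) = g} \<rightarrow> {P. P \<subseteq> V \<and> B \<subseteq> P \<and> signed g P \<in> H}"
    using inv heightsD(3) B_subset_V by fastforce
  show "{u \<in> V. signed g P u > 0} = P" if "P \<in> {P. P \<subseteq> V \<and> B \<subseteq> P \<and> signed g P \<in> H}" for P
  proof -
    have "signed g P u > 0 \<longleftrightarrow> u \<in> P" if "u \<in> V" for u
      using that g_pos[of u] by (auto simp: signed_def)
    then show ?thesis using that by auto
  qed
qed

text \<open>The identity holds edge by edge. If \<open>g = 1\<close> at both ends, then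
  \<open>c e\<close> times the factor is \<open>c e\<close> for equal signs and 1 for opposite
  signs, because \<open>1 - abs_param g e = 1 / c e\<close>. On any other edge the factor is the
  indicator of equal signs, which is what the Lipschitz constraint demands.\<close>

lemma hweight_signed:
  assumes g: "g \<in> (\<lambda>h u. \<bar>h u\<bar>) ` H" and P: "P \<subseteq> V" "B \<subseteq> P"
  shows "(if signed g P \<in> H then W (signed g P) else 0)
    = W g * (\<Prod>e\<in>E. abs_param g e * of_bool (e \<subseteq> P \<or> e \<inter> P = {}) + (1 - abs_param g e))"
proof -
  let ?f = "\<lambda>e. abs_param g e * of_bool (e \<subseteq> P \<or> e \<inter> P = {}) + (1 - abs_param g e)"
  obtain h0 where h0: "h0 \<in> H" "g = (\<lambda>u. \<bar>h0 u\<bar>)" using g by auto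
  have g_odd: "odd (g u)" and g_pos: "g u > 0" for u
    using h0 heightsD(1)[OF h0(1), of u] by (auto simp: dvd_abs_iff)
  have gap: "\<bar>g a - g b\<bar> \<le> 2" if "{a, b} \<in> E" for a b
    using heightsD(4)[OF h0(1) that] h0(2) by auto
  have not_ok: "?f {a, b} = 0" if ab: "{a, b} \<in> E" "\<not> \<bar>signed g P a - signed g P b\<bar> \<le> 2" for a b
  proof -
    have "a \<in> V" "b \<in> V" using ab(1) subgraph by (auto simp: fin_conn_subgraph_def)
    then have "a \<in> P \<longleftrightarrow> b \<notin> P" "g a \<noteq> 1 \<or> g b \<noteq> 1"
      using ab(2) gap[OF ab(1)] by (auto simp: signed_def split: if_splits)
    then show ?thesis by (auto simp: abs_param_def)
  qed
  have ok: "(if \<forall>a\<in>e. \<forall>b\<in>e. signed g P a = signed g P b then c e else 1)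
      = (if \<forall>a\<in>e. \<forall>b\<in>e. g a = g b then c e else 1) * ?f e"
    if e: "e \<in> E" and sH: "signed g P \<in> H" for e
  proof -
    obtain a b where ab: "e = {a, b}" "a \<in> V" "b \<in> V" using edge_cases[OF e] .
    have le: "\<bar>signed g P a - signed g P b\<bar> \<le> 2" using heightsD(4)[OF sH] e ab(1) by simp
    show ?thesis
    proof (cases "a \<in> P \<longleftrightarrow> b \<in> P")
      case True
      then have "e \<subseteq> P \<or> e \<inter> P = {}" "signed g P a = signed g P b \<longleftrightarrow> g a = g b"
        using ab by (auto simp: signed_def)
      then show ?thesis using ab(1) by (auto simp: eq_commute)
    next
      case False
      then have "g a + g b \<le> 2" using le g_pos[of a] g_pos[of b] ab by (auto simp: signed_def split: if_splits)
      then have "g a = 1" "g b = 1" using g_pos[of a] g_pos[of b] by linarith+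
      moreover have "signed g P a \<noteq> signed g P b"
        using False ab g_pos[of a] g_pos[of b] by (auto simp: signed_def)
      ultimately show ?thesis using False ab(1) c_ge_1[OF e] by (auto simp: abs_param_def)
    qed
  qed
  show ?thesis
  proof (cases "signed g P \<in> H")
    case True
    then show ?thesis using ok unfolding hweight_def prod.distrib[symmetric] by (simp cong: prod.cong)
  next
    case False
    \<comment> \<open>Parity, boundary values and exterior values of \<open>signed g P\<close> are
      automatic, so it can leave \<open>H\<close> only through an edge that breaks the Lipschitz
      bound, and the factor of that edge is 0.\<close>
    have "\<exists>a b. {a, b} \<in> E \<and> \<not> \<bar>signed g P a - signed g P b\<bar> \<le> 2"
    proof (rule ccontr)
      assume "\<not> ?thesis"
      moreover have "odd (signed g P u)" for u using g_odd by (simp add: signed_def)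
      moreover have "signed g P u = 1" if "u \<notin> V" for u
        using that heightsD(2)[OF h0(1)] h0(2) by (simp add: signed_def)
      moreover have "signed g P u = 1" if "u \<in> B" for u
        using that heightsD(3)[OF h0(1)] h0(2) P by (auto simp: signed_def)
      ultimately have "signed g P \<in> H" by (intro heightsI) auto
      then show False using False by simp
    qed
    then obtain e where "e \<in> E" "?f e = 0" using not_ok by blast
    then have "\<exists>e\<in>E. ?f e = 0" by blast
    then have "(\<Prod>e\<in>E. ?f e) = 0" by (rule prod_zero[OF finite_E])
    then show ?thesis using False by simp
  qed
qed

text \<open>The Edwards-Sokal coupling: after expansion over open edge sets \<open>w\<close>, the
  surviving plus sets are those constant on the edges of \<open>w\<close>. The function
  \<open>s\<close> is taken as 1 for the total mass and as the sign for the expectation.\<close>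

lemma sum_fixed_abs:
  assumes g: "g \<in> (\<lambda>h u. \<bar>h u\<bar>) ` H" and v: "v \<in> V"
  shows "(\<Sum>h\<in>{h \<in> H. (\<lambda>u. \<bar>h u\<bar>) = g}. W h * s (h v > 0)) =
    W g * (\<Sum>w\<in>Pow E. edge_prod (abs_param g) E w * (\<Sum>P\<in>plus_sets V B w. s (v \<in> P)))"
proof -
  let ?same = "\<lambda>P e. e \<subseteq> P \<or> e \<inter> P = {}"
  let ?Plus = "{P. P \<subseteq> V \<and> B \<subseteq> P}"
  have g_pos: "g u > 0" for u
    using g heightsD(1)[of _ u] by force
  have fin: "finite ?Plus" using finite_V by (auto intro: finite_subset[of _ "Pow V"])
  have sgn: "signed g P v > 0 \<longleftrightarrow> v \<in> P" for P using v g_pos[of v] by (auto simp: signed_def)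
  have plus: "plus_sets V B w = {P \<in> ?Plus. \<forall>e\<in>w. ?same P e}" if w: "w \<subseteq> E" for w
  proof (intro equalityI subsetI)
    fix P assume P: "P \<in> plus_sets V B w"
    then have P': "P \<in> spin_sets V B w" by (simp add: plus_sets_def)
    have "?same P e" if "e \<in> w" for e
    proof -
      have "e \<in> E" using that w by auto
      then obtain a b where "e = {a, b}" by (rule edge_cases)
      then show ?thesis using spin_sets_edge[OF P', of a b] that by auto
    qed
    then show "P \<in> {P \<in> ?Plus. \<forall>e\<in>w. ?same P e}" using P by (auto simp: plus_sets_def spin_sets_def)
  next
    fix P assume P: "P \<in> {P \<in> ?Plus. \<forall>e\<in>w. ?same P e}"
    have "b \<in> P" if "{a, b} \<in> w" "a \<in> P" for a b using P that by auto
    then show "P \<in> plus_sets V B w" using P by (auto simp: plus_sets_def spin_sets_def)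
  qed
  have prod_ind: "(\<Prod>e\<in>w. of_bool (?same P e)) = (of_bool (\<forall>e\<in>w. ?same P e) :: real)" if "w \<subseteq> E" for w P
    using finite_subset[OF that finite_E] by induction auto
  have "(\<Sum>h\<in>{h \<in> H. (\<lambda>u. \<bar>h u\<bar>) = g}. W h * s (h v > 0))
      = (\<Sum>P\<in>{P. P \<subseteq> V \<and> B \<subseteq> P \<and> signed g P \<in> H}. W (signed g P) * s (v \<in> P))"
    using sum.reindex_bij_betw[OF bij_betw_signed[OF g], of "\<lambda>h. W h * s (h v > 0)"] by (simp add: sgn)
  also have "\<dots> = (\<Sum>P\<in>?Plus. (if signed g P \<in> H then W (signed g P) else 0) * s (v \<in> P))"
    by (rule sum.mono_neutral_cong_left[OF fin]) auto
  also have "\<dots> = (\<Sum>P\<in>?Plus. W g * (\<Sum>w\<in>Pow E. edge_prod (abs_param g) E w * of_bool (\<forall>e\<in>w. ?same P e)) * s (v \<in> P))"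
  proof (intro sum.cong refl)
    fix P assume P: "P \<in> ?Plus"
    have "(\<Prod>e\<in>E. abs_param g e * of_bool (?same P e) + (1 - abs_param g e))
        = (\<Sum>w\<in>Pow E. edge_prod (abs_param g) E w * of_bool (\<forall>e\<in>w. ?same P e))"
      unfolding sum_edge_prod_mult[OF finite_E, symmetric] by (intro sum.cong refl) (simp only: Pow_iff prod_ind)
    then show "(if signed g P \<in> H then W (signed g P) else 0) * s (v \<in> P)
        = W g * (\<Sum>w\<in>Pow E. edge_prod (abs_param g) E w * of_bool (\<forall>e\<in>w. ?same P e)) * s (v \<in> P)"
      using hweight_signed[OF g, of P] P by simp
  qed
  also have "\<dots> = W g * (\<Sum>P\<in>?Plus. \<Sum>w\<in>Pow E. edge_prod (abs_param g) E w * (of_bool (\<forall>e\<in>w. ?same P e) * s (v \<in> P)))"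
    by (simp only: sum_distrib_left sum_distrib_right mult.assoc)
  also have "\<dots> = W g * (\<Sum>w\<in>Pow E. \<Sum>P\<in>?Plus. edge_prod (abs_param g) E w * (of_bool (\<forall>e\<in>w. ?same P e) * s (v \<in> P)))"
    by (subst sum.swap) (rule refl)
  also have "\<dots> = W g * (\<Sum>w\<in>Pow E. edge_prod (abs_param g) E w * (\<Sum>P\<in>plus_sets V B w. s (v \<in> P)))"
  proof (intro arg_cong[where f = "\<lambda>x. W g * x"] sum.cong refl)
    fix w assume w: "w \<in> Pow E"
    have "(\<Sum>P\<in>?Plus. of_bool (\<forall>e\<in>w. ?same P e) * s (v \<in> P)) = (\<Sum>P\<in>plus_sets V B w. s (v \<in> P))"
      by (rule sum.mono_neutral_cong_right[OF fin]) (use w plus[of w] in auto)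
    then show "(\<Sum>P\<in>?Plus. edge_prod (abs_param g) E w * (of_bool (\<forall>e\<in>w. ?same P e) * s (v \<in> P)))
        = edge_prod (abs_param g) E w * (\<Sum>P\<in>plus_sets V B w. s (v \<in> P))"
      by (simp only: sum_distrib_left[symmetric])
  qed
  finally show ?thesis .
qed

text \<open>In each fibre over \<open>|h|\<close> the mean sign at \<open>v\<close> is an FK
  probability of connection to the boundary, with parameters at least those of the hypothesis. The
  resulting bound is the same in all fibres and is summed over them.\<close>

theorem sign_sum_ge:
  assumes v: "v \<in> V" and \<theta>: "\<theta> \<le> fk_prob adj (\<lambda>e. 1 - 1 / c e) V E (bdry_conn adj V E v)"
  shows "\<theta> * (\<Sum>h\<in>H. W h) \<le> (\<Sum>h\<in>H. W h * (if h v > 0 then 1 else -1))"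
proof -
  let ?p = "\<lambda>e. 1 - 1 / c e" and ?A = "bdry_conn adj V E v"
  let ?abs = "\<lambda>h u. \<bar>h u :: int\<bar>"
  have p01: "0 \<le> ?p e \<and> ?p e \<le> 1" if "e \<in> E" for e using c_ge_1[OF that] by auto
  have fixed: "\<theta> * (\<Sum>h\<in>{h \<in> H. ?abs h = g}. W h)
      \<le> (\<Sum>h\<in>{h \<in> H. ?abs h = g}. W h * (if h v > 0 then 1 else -1))" if g: "g \<in> ?abs ` H" for g
  proof -
    let ?q = "abs_param g"
    have q: "0 \<le> ?p e \<and> ?p e \<le> ?q e \<and> ?q e \<le> 1" if "e \<in> E" for e
      using p01[OF that] by (auto simp: abs_param_def)
    have eV: "\<forall>e\<in>w. e \<subseteq> V" if "w \<subseteq> E" for w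
      using that subgraph by (auto simp: fin_conn_subgraph_def)
    have card: "real (card (spin_sets V B w)) = 2 * card (plus_sets V B w)" if "w \<subseteq> E" for w
      using card_plus_sets[OF finite_V B_subset_V bdry_ne eV[OF that]] by simp
    \<comment> \<open>The factor 2 is the global flip: plus sets are half of the spin sets.\<close>
    have one: "2 * (\<Sum>h\<in>{h \<in> H. ?abs h = g}. W h) = W g * (\<Sum>w\<in>Pow E. wired_weight V B ?q E w)"
      using sum_fixed_abs[OF g v, of "\<lambda>_. 1"]
      by (simp add: wired_weight_def card sum_distrib_left mult_ac)
    have sgn: "2 * (\<Sum>h\<in>{h \<in> H. ?abs h = g}. W h * (if h v > 0 then 1 else -1))
        = W g * (\<Sum>w\<in>Pow E. wired_weight V B ?q E w * of_bool (?A w))"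
    proof -
      have "2 * (edge_prod ?q E w * (\<Sum>P\<in>plus_sets V B w. if v \<in> P then 1 else -1))
          = wired_weight V B ?q E w * of_bool (?A w)" if w: "w \<in> Pow E" for w
        using sum_sign_plus_sets[OF v eV, of w B] w card[of w]
        by (simp add: wired_weight_def bdry_conn_def)
      then show ?thesis
        unfolding sum_fixed_abs[OF g v, of "\<lambda>b. if b then 1 else -1"]
        unfolding mult.left_commute[of 2] sum_distrib_left[of 2]
        by (intro arg_cong[where f = "\<lambda>x. W g * x"] sum.cong refl)
    qed
    have pos: "(\<Sum>w\<in>Pow E. wired_weight V B ?p E w) > 0"
      using sum_wired_weight_pos[OF finite_V finite_E p01] .
    have nonneg: "(\<Sum>w\<in>Pow E. wired_weight V B ?q E w) \<ge> 0"
      by (rule less_imp_le, rule sum_wired_weight_pos[OF finite_V finite_E]) (use q in force)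
    have "\<theta> * (\<Sum>w\<in>Pow E. wired_weight V B ?p E w) \<le> (\<Sum>w\<in>Pow E. wired_weight V B ?p E w * of_bool (?A w))"
      using \<theta> pos unfolding fk_prob_eq_wired_weight[OF subgraph] by (simp add: pos_le_divide_eq)
    then have "\<theta> * (\<Sum>w\<in>Pow E. wired_weight V B ?p E w) * (\<Sum>w\<in>Pow E. wired_weight V B ?q E w)
        \<le> (\<Sum>w\<in>Pow E. wired_weight V B ?p E w * of_bool (?A w)) * (\<Sum>w\<in>Pow E. wired_weight V B ?q E w)"
      using nonneg by (rule mult_right_mono)
    also have "\<dots> \<le> (\<Sum>w\<in>Pow E. wired_weight V B ?q E w * of_bool (?A w)) * (\<Sum>w\<in>Pow E. wired_weight V B ?p E w)"
      by (rule wired_weight_comparison[OF finite_V finite_E subset_refl q bdry_conn_mono])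
    finally have "\<theta> * (\<Sum>w\<in>Pow E. wired_weight V B ?q E w) \<le> (\<Sum>w\<in>Pow E. wired_weight V B ?q E w * of_bool (?A w))"
      using pos by (simp add: mult_ac)
    then have "W g * (\<theta> * (\<Sum>w\<in>Pow E. wired_weight V B ?q E w)) \<le> W g * (\<Sum>w\<in>Pow E. wired_weight V B ?q E w * of_bool (?A w))"
      using W_pos[of g] by simp
    then have "\<theta> * (2 * (\<Sum>h\<in>{h \<in> H. ?abs h = g}. W h))
        \<le> 2 * (\<Sum>h\<in>{h \<in> H. ?abs h = g}. W h * (if h v > 0 then 1 else -1))"
      unfolding sgn one by (simp add: mult.left_commute)
    then show ?thesis by simp
  qed
  have "\<theta> * (\<Sum>h\<in>H. W h) = (\<Sum>g\<in>?abs ` H. \<theta> * (\<Sum>h\<in>{h \<in> H. ?abs h = g}. W h))"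
    by (simp only: sum.image_gen[OF finite_H, of W ?abs] sum_distrib_left)
  also have "\<dots> \<le> (\<Sum>g\<in>?abs ` H. \<Sum>h\<in>{h \<in> H. ?abs h = g}. W h * (if h v > 0 then 1 else -1))"
    by (intro sum_mono fixed)
  also have "\<dots> = (\<Sum>h\<in>H. W h * (if h v > 0 then 1 else -1))"
    by (rule sum.image_gen[OF finite_H, symmetric])
  finally show ?thesis .
qed

end

section \<open>Log-concavity and localisation\<close>

text \<open>Two odd numbers at distance at most 2 have no odd number strictly between them. So if
  one pair is constant, its value lies on one side of both entries of the other pair, and equality
  survives in the maximum or in the minimum.\<close>

lemma edge_factor_submodular:
  fixes C :: real and fa fb ga gb :: int
  assumes "C \<ge> 1" and par: "odd fa" "odd fb" "odd ga" "odd gb"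
    and lip: "\<bar>fa - fb\<bar> \<le> 2" "\<bar>ga - gb\<bar> \<le> 2"
  shows "(if fa = fb then C else 1) * (if ga = gb then C else 1)
    \<le> (if max fa ga = max fb gb then C else 1) * (if min fa ga = min fb gb then C else 1)"
proof -
  have *: "max t s = max t s' \<or> min t s = min t s'"
    if "odd t" "odd s" "odd s'" "\<bar>s - s'\<bar> \<le> 2" for t s s' :: int
  proof -
    have "t \<le> s \<and> t \<le> s' \<or> s \<le> t \<and> s' \<le> t"
      using that by presburger
    then show ?thesis by auto
  qed
  consider "fa = fb" "ga = gb" | "fa \<noteq> fb" "ga \<noteq> gb" | "fa = fb" "ga \<noteq> gb" | "fa \<noteq> fb" "ga = gb"
    by blast
  then show ?thesis
  proof cases
    case 3
    then show ?thesis using *[of fa ga gb] par lip assms(1) by auto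
  next
    case 4
    then show ?thesis using *[of ga fa fb] par lip assms(1) by (auto simp: max.commute min.commute)
  next
    case 2
    have "C * C \<ge> 1" using mult_mono[OF assms(1) assms(1)] assms(1) by simp
    then show ?thesis using 2 assms(1) by auto
  qed auto
qed

text \<open>From \<open>m * a m \<le> Z\<close> and \<open>\<theta> * Z \<le> a 0\<close>, the
  choice \<open>m \<ge> 4 / \<theta>\<close> gives \<open>a m \<le> a 0 / 4\<close>, and
  log-concavity makes every shift by \<open>m\<close> cost a factor 4. The square grows under the
  shift only by a factor 2 up to a constant, so the tail is at most half the whole sum plus a
  multiple of \<open>Z\<close>, and that half is absorbed.\<close>

lemma second_moment_le:
  fixes a :: "nat \<Rightarrow> real"
  assumes nonneg: "\<And>j. 0 \<le> a j"
    and submult: "\<And>j m. a 0 * a (j + m) \<le> a j * a m"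
    and decr: "\<And>j. a (Suc j) \<le> a j"
    and sum_le: "\<And>K. (\<Sum>j<K. a j) \<le> Z"
    and "Z > 0" "\<theta> > 0" "\<theta> * Z \<le> a 0" "4 / \<theta> \<le> real m"
  shows "(\<Sum>j<K. (real j)\<^sup>2 * a j) \<le> 3 * (real m)\<^sup>2 * Z"
proof -
  have "a 0 > 0" using assms(5-7) by (meson mult_pos_pos less_le_trans)
  have "antimono a" using decr by (simp add: decseq_SucI)
  have "real m * a m \<le> (\<Sum>j<m. a j)"
    using sum_bounded_below[of "{..<m}" "a m" a] antimonoD[OF \<open>antimono a\<close>] by simp
  also have "\<dots> \<le> Z" by (rule sum_le)
  finally have m_am: "real m * a m \<le> Z" .
  have "4 \<le> \<theta> * real m" using assms(6,8) by (simp add: field_simps)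
  then have "4 * a m \<le> \<theta> * real m * a m" using nonneg by (intro mult_right_mono)
  also have "\<dots> \<le> \<theta> * Z" using m_am assms(6) by (simp add: mult.assoc)
  finally have am: "4 * a m \<le> a 0" using assms(7) by simp
  have shift: "4 * a (j + m) \<le> a j" for j
  proof -
    have "a 0 * (4 * a (j + m)) \<le> a j * (4 * a m)" using submult[of j m] by simp
    also have "\<dots> \<le> a j * a 0" using am nonneg by (intro mult_left_mono)
    finally show ?thesis using \<open>a 0 > 0\<close> by (simp add: mult.commute)
  qed
  let ?S = "\<Sum>j<K. (real j)\<^sup>2 * a j"
  have "?S \<le> (\<Sum>j<m + K. (real j)\<^sup>2 * a j)"
    using nonneg by (intro sum_mono2) auto
  also have "\<dots> = (\<Sum>j<m. (real j)\<^sup>2 * a j) + (\<Sum>j<K. (real (j + m))\<^sup>2 * a (j + m))"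
    by (induction K) (simp_all add: add.commute)
  also have "(\<Sum>j<m. (real j)\<^sup>2 * a j) \<le> (\<Sum>j<m. (real m)\<^sup>2 * a j)"
    using nonneg by (intro sum_mono mult_right_mono power_mono) auto
  also have "\<dots> \<le> (real m)\<^sup>2 * Z"
    using sum_le[of m] by (simp add: sum_distrib_left[symmetric] mult_left_mono)
  also have "(\<Sum>j<K. (real (j + m))\<^sup>2 * a (j + m)) \<le> (\<Sum>j<K. (1 / 2) * ((real j)\<^sup>2 * a j) + (real m)\<^sup>2 / 2 * a j)"
  proof (intro sum_mono)
    fix j
    have "(real (j + m))\<^sup>2 \<le> 2 * (real j)\<^sup>2 + 2 * (real m)\<^sup>2"
      using sum_squares_bound[of "real j" "real m"] by (simp add: power2_sum)
    then have "(real (j + m))\<^sup>2 * a (j + m) \<le> (2 * (real j)\<^sup>2 + 2 * (real m)\<^sup>2) * (a j / 4)"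
      using shift[of j] nonneg by (intro mult_mono) auto
    then show "(real (j + m))\<^sup>2 * a (j + m) \<le> (1 / 2) * ((real j)\<^sup>2 * a j) + (real m)\<^sup>2 / 2 * a j"
      by (simp add: algebra_simps)
  qed
  also have "\<dots> = ?S / 2 + (real m)\<^sup>2 / 2 * (\<Sum>j<K. a j)"
    by (simp add: sum.distrib sum_distrib_left[symmetric] sum_divide_distrib[symmetric])
  also have "(real m)\<^sup>2 / 2 * (\<Sum>j<K. a j) \<le> (real m)\<^sup>2 / 2 * Z"
    using sum_le[of K] by (intro mult_left_mono) auto
  \<comment> \<open>The collected bound is \<open>?S \<le> m^2 * Z + ?S / 2 + m^2 / 2 * Z\<close>,
    whence the 3.\<close>
  finally show ?thesis by (simp add: field_simps)
qed

section \<open>The law of the height at one vertex\<close>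

context height_domain
begin

definition level :: "'v \<Rightarrow> int \<Rightarrow> real" where
  "level v k = (\<Sum>h\<in>{h \<in> H. h v = k}. W h)"

lemma level_nonneg: "0 \<le> level v k"
  unfolding level_def using W_pos by (intro sum_nonneg) (auto intro: less_imp_le)

text \<open>The four functions theorem applied to \<open>h\<close> and to a second height function lowered by \<open>m\<close>:
  on the boundary the maximum comes from the first one, at \<open>v\<close> from the second one.\<close>

lemma level_mult_le:
  assumes v: "v \<in> V" and m: "0 \<le> m" "even m" and il: "i \<le> l - m"
  shows "level v i * level v l \<le> level v (l - m) * level v (i + m)"
proof -
  obtain M where M: "\<forall>h\<in>H. \<forall>u. \<bar>h u\<bar> \<le> M" using heights_bounded by blast
  \<comment> \<open>The range is enlarged by \<open>m\<close> to hold lowered heights. A box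
    function represents the lowered copy and \<open>sh\<close> restores the height function, acting
    only on \<open>V\<close> so that the default 1 elsewhere is kept.\<close>
  define L where "L = {- (M + m) .. M + m}"
  define sh where "sh f u = (if u \<in> V then f u + m else f u)" for f :: "'v \<Rightarrow> int" and u
  define wt where "wt k f = (if f \<in> H \<and> f v = k then W f else 0)" for k f
  have finL: "finite (box_funs V L 1)" using finite_box_funs[OF finite_V, of L] by (simp add: L_def)
  have HL: "f \<in> box_funs V L 1" if "f \<in> H" for f
  proof -
    have "h u \<in> L" if "h \<in> H" for h u
    proof -
      have "\<bar>h u\<bar> \<le> M" using M that by blast
      then show ?thesis using m(1) by (auto simp: L_def)
    qed
    then show ?thesis using heights_subset_box[of L] that by blast
  qed
  have sum_wt: "sum (wt k) (box_funs V L 1) = level v k" for k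
    unfolding level_def by (rule sum.mono_neutral_cong_right[OF finL]) (use HL in \<open>auto simp: wt_def\<close>)
  have sum_wt_sh: "(\<Sum>f\<in>box_funs V L 1. wt k (sh f)) = level v k" for k
  proof -
    have "bij_betw sh {f \<in> box_funs V L 1. sh f \<in> H \<and> sh f v = k} {h \<in> H. h v = k}"
    proof (rule bij_betwI[where g = "\<lambda>h u. if u \<in> V then h u - m else h u"])
      have inv: "sh (\<lambda>u. if u \<in> V then h u - m else h u) = h" for h by (auto simp: sh_def)
      have "(\<lambda>u. if u \<in> V then h u - m else h u) \<in> box_funs V L 1" if "h \<in> H" for h
      proof -
        have "h u - m \<in> L" for u
        proof -
          have "\<bar>h u\<bar> \<le> M" using M that by blast
          then show ?thesis using m(1) by (auto simp: L_def)
        qed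
        then show ?thesis using heightsD(2)[OF that] by (auto simp: box_funs_def)
      qed
      then show "(\<lambda>h u. if u \<in> V then h u - m else h u) \<in> {h \<in> H. h v = k} \<rightarrow> {f \<in> box_funs V L 1. sh f \<in> H \<and> sh f v = k}"
        using inv by auto
    qed (auto simp: sh_def)
    from sum.reindex_bij_betw[OF this, of W]
    have "(\<Sum>f\<in>{f \<in> box_funs V L 1. sh f \<in> H \<and> sh f v = k}. W (sh f)) = level v k"
      by (simp add: level_def)
    moreover have "(\<Sum>f\<in>box_funs V L 1. wt k (sh f)) = (\<Sum>f\<in>{f \<in> box_funs V L 1. sh f \<in> H \<and> sh f v = k}. W (sh f))"
      by (rule sum.mono_neutral_cong_right[OF finL]) (auto simp: wt_def)
    ultimately show ?thesis by simp
  qed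
  have wt_nonneg: "0 \<le> wt k f" for k f using W_pos[of f] by (simp add: wt_def less_imp_le)
  have "sum (wt i) (box_funs V L 1) * (\<Sum>f\<in>box_funs V L 1. wt l (sh f))
      \<le> sum (wt (l - m)) (box_funs V L 1) * (\<Sum>f\<in>box_funs V L 1. wt (i + m) (sh f))"
    using finite_V
  proof (rule four_functions)
    fix f g assume fg: "f \<in> box_funs V L 1" "g \<in> box_funs V L 1"
    let ?mx = "\<lambda>u. max (f u) (g u)" and ?mn = "sh (\<lambda>u. min (f u) (g u))"
    show "wt i f * wt l (sh g) \<le> wt (l - m) ?mx * wt (i + m) ?mn"
    proof (cases "f \<in> H \<and> f v = i \<and> sh g \<in> H \<and> sh g v = l")
      case False
      then have "wt i f * wt l (sh g) = 0" by (auto simp: wt_def)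
      also have "0 \<le> wt (l - m) ?mx * wt (i + m) ?mn" by (intro mult_nonneg_nonneg wt_nonneg)
      finally show ?thesis .
    next
      case True
      then have f: "f \<in> H" "f v = i" and g: "sh g \<in> H" "sh g v = l" by auto
      have gV: "g u = sh g u - m" if "u \<in> V" for u using that by (simp add: sh_def)
      have out: "f u = 1" "g u = 1" if "u \<notin> V" for u using fg that by (auto simp: box_funs_def)
      have f_odd: "odd (f u)" for u by (rule heightsD(1)[OF f(1)])
      have g_odd: "odd (g u)" if "u \<in> V" for u
        using heightsD(1)[OF g(1), of u] gV[OF that] m(2) by simp
      have fB: "f u = 1" and gB: "g u = 1 - m" if "u \<in> B" for u
        using heightsD(3)[OF f(1) that] heightsD(3)[OF g(1) that] gV[of u] B_subset_V that by auto
      have edge_V: "a \<in> V" "b \<in> V" if "{a, b} \<in> E" for a b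
        using that subgraph by (auto simp: fin_conn_subgraph_def)
      have f_lip: "\<bar>f a - f b\<bar> \<le> 2" and g_lip: "\<bar>g a - g b\<bar> \<le> 2" if "{a, b} \<in> E" for a b
        using heightsD(4)[OF f(1) that] heightsD(4)[OF g(1) that] gV edge_V[OF that] by auto
      have mx: "?mx \<in> H"
      proof (rule heightsI)
        show "odd (?mx u)" if "u \<in> V" for u using f_odd[of u] g_odd[OF that] by (simp add: max_def)
        show "?mx u = 1" if "u \<notin> V" for u using out[OF that] by simp
        show "?mx u = 1" if "u \<in> B" for u using fB[OF that] gB[OF that] m(1) by simp
        show "\<bar>?mx a - ?mx b\<bar> \<le> 2" if "{a, b} \<in> E" for a b
          using f_lip[OF that] g_lip[OF that] by linarith
      qed
      have mn: "?mn \<in> H"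
      proof (rule heightsI)
        show "odd (?mn u)" if "u \<in> V" for u
          using f_odd[of u] g_odd[OF that] m(2) that by (simp add: min_def sh_def)
        show "?mn u = 1" if "u \<notin> V" for u using out[OF that] that by (simp add: sh_def)
        show "?mn u = 1" if "u \<in> B" for u
          using fB[OF that] gB[OF that] m(1) B_subset_V that by (auto simp: sh_def)
        show "\<bar>?mn a - ?mn b\<bar> \<le> 2" if "{a, b} \<in> E" for a b
          unfolding sh_def using f_lip[OF that] g_lip[OF that] edge_V[OF that] by (simp add: min_def) linarith
      qed
      have "W f * W (sh g) \<le> W ?mx * W ?mn"
        unfolding hweight_def prod.distrib[symmetric]
      proof (intro prod_mono conjI)
        fix e assume e: "e \<in> E"
        then obtain a b where ab: "e = {a, b}" "a \<in> V" "b \<in> V" by (rule edge_cases)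
        have const: "(\<forall>a\<in>e. \<forall>b\<in>e. h a = h b) \<longleftrightarrow> h a = h b" for h :: "'v \<Rightarrow> int" using ab(1) by auto
        have "sh h a = sh h b \<longleftrightarrow> h a = h b" for h using ab by (simp add: sh_def)
        then show "(if \<forall>a\<in>e. \<forall>b\<in>e. f a = f b then c e else 1) * (if \<forall>a\<in>e. \<forall>b\<in>e. sh g a = sh g b then c e else 1)
            \<le> (if \<forall>a\<in>e. \<forall>b\<in>e. ?mx a = ?mx b then c e else 1) * (if \<forall>a\<in>e. \<forall>b\<in>e. ?mn a = ?mn b then c e else 1)"
          unfolding const
          using edge_factor_submodular[OF c_ge_1[OF e] f_odd f_odd g_odd[OF ab(2)] g_odd[OF ab(3)] f_lip g_lip] e ab(1)
          by simp
        show "0 \<le> (if \<forall>a\<in>e. \<forall>b\<in>e. f a = f b then c e else 1) * (if \<forall>a\<in>e. \<forall>b\<in>e. sh g a = sh g b then c e else 1)"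
          using c_ge_1[OF e] by auto
      qed
      moreover have "g v = l - m" using g(2) gV[OF v] by simp
      then have "?mx v = l - m" "?mn v = i + m" using f(2) il v by (simp_all add: sh_def)
      moreover have "wt i f = W f" "wt l (sh g) = W (sh g)" using f g by (simp_all only: wt_def simp_thms if_True)
      ultimately show ?thesis using mx mn by (simp only: wt_def simp_thms if_True)
    qed
  qed (use wt_nonneg in auto)
  then show ?thesis by (simp only: sum_wt sum_wt_sh)
qed

lemma bij_betw_reflect: "bij_betw (\<lambda>h u. 2 - h u) H H"
proof -
  have "(\<lambda>u. 2 - h u) \<in> H" if "h \<in> H" for h
  proof (rule heightsI)
    show "\<bar>2 - h a - (2 - h b)\<bar> \<le> 2" if "{a, b} \<in> E" for a b
      using heightsD(4)[OF \<open>h \<in> H\<close> that] by (simp add: abs_minus_commute)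
  qed (use heightsD[OF that] in auto)
  then show ?thesis by (intro bij_betwI[where g = "\<lambda>h u. 2 - h u"]) auto
qed

lemma hweight_reflect: "W (\<lambda>u. 2 - h u) = W h"
  by (simp add: hweight_def)

lemma sum_reflect: "(\<Sum>h\<in>H. W h * F (2 - h v)) = (\<Sum>h\<in>H. W h * F (h v))"
  using sum.reindex_bij_betw[OF bij_betw_reflect, of "\<lambda>h. W h * F (h v)"] by (simp add: hweight_reflect)

lemma level_eq_sum: "level v k = (\<Sum>h\<in>H. W h * of_bool (h v = k))"
  unfolding level_def by (rule sum.mono_neutral_cong_left[OF finite_H]) auto

lemma level_reflect: "level v (2 - k) = level v k"
proof -
  have "2 - h v = k \<longleftrightarrow> h v = 2 - k" for h :: "'v \<Rightarrow> int" by auto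
  then show ?thesis using sum_reflect[of "\<lambda>x. of_bool (x = k)" v] by (simp add: level_eq_sum)
qed

text \<open>For odd \<open>k\<close> the signs of \<open>k\<close> and \<open>2 - k\<close> cancel
  unless \<open>k = 1\<close>, where both are plus.\<close>

lemma sign_sum_eq_level: "(\<Sum>h\<in>H. W h * (if h v > 0 then 1 else -1)) = level v 1"
proof -
  let ?s = "\<lambda>k :: int. if k > 0 then 1 else -1 :: real"
  have "2 * (\<Sum>h\<in>H. W h * ?s (h v)) = (\<Sum>h\<in>H. W h * ?s (h v)) + (\<Sum>h\<in>H. W h * ?s (2 - h v))"
    using sum_reflect[of ?s v] by simp
  also have "\<dots> = (\<Sum>h\<in>H. 2 * (W h * of_bool (h v = 1)))"
    unfolding sum.distrib[symmetric]
  proof (intro sum.cong refl)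
    fix h assume "h \<in> H"
    then have "odd (h v)" by (rule heightsD(1))
    then have "h v = 1 \<or> h v > 2 \<or> h v \<le> 0" by presburger
    then show "W h * ?s (h v) + W h * ?s (2 - h v) = 2 * (W h * of_bool (h v = 1))" by auto
  qed
  also have "\<dots> = 2 * level v 1" by (simp add: level_eq_sum sum_distrib_left)
  finally show ?thesis by simp
qed

theorem second_moment_bound:
  assumes v: "v \<in> V" and \<theta>: "\<theta> > 0" "\<theta> \<le> fk_prob adj (\<lambda>e. 1 - 1 / c e) V E (bdry_conn adj V E v)"
    and m: "4 / \<theta> \<le> real m"
  shows "(\<Sum>h\<in>H. W h * (real_of_int (h v - 1))\<^sup>2) \<le> 24 * (real m)\<^sup>2 * (\<Sum>h\<in>H. W h)"
proof -
  \<comment> \<open>The mass \<open>j\<close> steps of size 2 above the centre 1; reflection gives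
    the same mass \<open>j\<close> steps below.\<close>
  define a where "a j = level v (1 + 2 * int j)" for j
  define J where "J h = nat (\<bar>h v - 1\<bar> div 2)" for h :: "'v \<Rightarrow> int"
  let ?Z = "\<Sum>h\<in>H. W h"
  have J: "h v = 1 + 2 * int (J h) \<or> h v = 1 - 2 * int (J h)" if h: "h \<in> H" for h
  proof -
    obtain t where "h v = 2 * t + 1" using heightsD(1)[OF h, of v] by (rule oddE)
    then show ?thesis by (auto simp: J_def abs_mult)
  qed
  have level_refl: "level v (1 - 2 * int j) = a j" for j
    using level_reflect[of v "1 + 2 * int j"] by (simp add: a_def)
  have a_nonneg: "0 \<le> a j" for j by (simp add: a_def level_nonneg)
  have submult: "a 0 * a (j + k) \<le> a j * a k" for j k
    using level_mult_le[OF v, of "2 * int k" 1 "1 + 2 * int (j + k)"] by (simp add: a_def algebra_simps)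
  have decr: "a (Suc j) \<le> a j" for j
  proof -
    \<comment> \<open>Two opposite levels are moved towards each other by 2; by symmetry both
      products are squares.\<close>
    have "level v (1 - 2 * int (Suc j)) * level v (1 + 2 * int (Suc j)) \<le> level v (1 + 2 * int j) * level v (1 - 2 * int j)"
      using level_mult_le[OF v, of 2 "1 - 2 * int (Suc j)" "1 + 2 * int (Suc j)"] by (simp add: algebra_simps)
    then have "(a (Suc j))\<^sup>2 \<le> (a j)\<^sup>2" by (simp only: level_refl power2_eq_square a_def[symmetric])
    then show ?thesis using a_nonneg by (rule power2_le_imp_le)
  qed
  have group: "(\<Sum>j<K. \<Sum>h\<in>{h \<in> H. J h = j}. F h) = (\<Sum>h\<in>{h \<in> H. J h < K}. F h)" for K and F :: "_ \<Rightarrow> real"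
  proof -
    have "{h \<in> H. J h = j} = {h \<in> {h \<in> H. J h < K}. J h = j}" if "j < K" for j using that by auto
    then show ?thesis
      using sum.group[of "{h \<in> H. J h < K}" "{..<K}" J F] finite_H by auto
  qed
  have sum_le: "(\<Sum>j<K. a j) \<le> ?Z" for K
  proof -
    have "(\<Sum>j<K. a j) \<le> (\<Sum>j<K. \<Sum>h\<in>{h \<in> H. J h = j}. W h)"
      unfolding a_def level_def
      by (intro sum_mono sum_mono2) (use finite_H W_pos in \<open>auto simp: J_def intro: less_imp_le\<close>)
    also have "\<dots> \<le> ?Z"
      unfolding group by (intro sum_mono2) (use finite_H W_pos in \<open>auto intro: less_imp_le\<close>)
    finally show ?thesis .
  qed
  have a0: "\<theta> * ?Z \<le> a 0"
    using sign_sum_ge[OF v \<theta>(2)] by (simp add: sign_sum_eq_level a_def)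
  obtain K where K: "\<forall>h\<in>H. J h < K"
    using finite_nat_set_iff_bounded[of "J ` H"] finite_H by auto
  \<comment> \<open>The 8 is 4 from squaring a step of size 2, times 2 for the two sides of 1; with
    the 3 of \<open>second_moment_le\<close> it gives 24.\<close>
  have fibre: "(\<Sum>h\<in>{h \<in> H. J h = j}. W h * (real_of_int (h v - 1))\<^sup>2) \<le> 8 * ((real j)\<^sup>2 * a j)" for j
  proof -
    have "(\<Sum>h\<in>{h \<in> H. J h = j}. W h * (real_of_int (h v - 1))\<^sup>2) = (\<Sum>h\<in>{h \<in> H. J h = j}. W h * (4 * (real j)\<^sup>2))"
    proof (intro sum.cong refl)
      fix h assume "h \<in> {h \<in> H. J h = j}"
      then have "h v = 1 + 2 * int j \<or> h v = 1 - 2 * int j" using J by auto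
      then show "W h * (real_of_int (h v - 1))\<^sup>2 = W h * (4 * (real j)\<^sup>2)"
        by (auto simp: power_mult_distrib)
    qed
    also have "\<dots> = (\<Sum>h\<in>{h \<in> H. J h = j}. W h) * (4 * (real j)\<^sup>2)"
      by (rule sum_distrib_right[symmetric])
    also have "(\<Sum>h\<in>{h \<in> H. J h = j}. W h) \<le> (\<Sum>h\<in>{h \<in> H. h v = 1 + 2 * int j} \<union> {h \<in> H. h v = 1 - 2 * int j}. W h)"
      by (intro sum_mono2) (use finite_H W_pos J in \<open>auto intro: less_imp_le\<close>)
    also have "\<dots> \<le> level v (1 + 2 * int j) + level v (1 - 2 * int j)"
      unfolding level_def using finite_H W_pos
      by (subst sum_Un) (auto intro!: sum_nonneg intro: less_imp_le)
    also have "\<dots> = 2 * a j" by (simp add: level_refl) (simp add: a_def)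
    finally show ?thesis by (simp add: mult_right_mono mult_ac)
  qed
  have "(\<Sum>h\<in>H. W h * (real_of_int (h v - 1))\<^sup>2) = (\<Sum>j<K. \<Sum>h\<in>{h \<in> H. J h = j}. W h * (real_of_int (h v - 1))\<^sup>2)"
    unfolding group using K by (intro sum.cong) auto
  also have "\<dots> \<le> (\<Sum>j<K. 8 * ((real j)\<^sup>2 * a j))" by (intro sum_mono fibre)
  also have "\<dots> = 8 * (\<Sum>j<K. (real j)\<^sup>2 * a j)" by (simp add: sum_distrib_left)
  also have "\<dots> \<le> 8 * (3 * (real m)\<^sup>2 * ?Z)"
    using second_moment_le[OF a_nonneg submult decr sum_le partition_pos \<theta>(1) a0 m, of K] by simp
  finally show ?thesis by simp
qed

text \<open>The second moment about 1 exceeds the variance by \<open>(m1 - 1)^2\<close>.\<close>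

lemma hvar_le:
  assumes "(\<Sum>h\<in>H. W h * (real_of_int (h x - 1))\<^sup>2) \<le> C * (\<Sum>h\<in>H. W h)"
  shows "hvar adj c V E x \<le> C"
proof -
  let ?Z = "\<Sum>h\<in>H. W h"
  define m1 where "m1 = hexp adj c V E (\<lambda>h. real_of_int (h x))"
  define m2 where "m2 = hexp adj c V E (\<lambda>h. (real_of_int (h x))\<^sup>2)"
  have "(\<Sum>h\<in>H. W h * (real_of_int (h x - 1))\<^sup>2)
      = (\<Sum>h\<in>H. W h * (real_of_int (h x))\<^sup>2) - 2 * (\<Sum>h\<in>H. W h * real_of_int (h x)) + ?Z"
    unfolding sum_distrib_left sum_subtractf[symmetric] sum.distrib[symmetric]
    by (intro sum.cong refl) (simp add: power2_eq_square algebra_simps)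
  then have "(\<Sum>h\<in>H. W h * (real_of_int (h x - 1))\<^sup>2) / ?Z = m2 - 2 * m1 + 1"
    using partition_pos by (simp add: m1_def m2_def hexp_def diff_divide_distrib add_divide_distrib)
  moreover have "(\<Sum>h\<in>H. W h * (real_of_int (h x - 1))\<^sup>2) / ?Z \<le> C"
    using assms partition_pos by (simp add: pos_divide_le_eq)
  moreover have "0 \<le> (m1 - 1)\<^sup>2" by simp
  ultimately show ?thesis
    by (simp add: hvar_def m1_def[symmetric] m2_def[symmetric] power2_diff)
qed

end

text \<open>Edges with \<open>c e = 1\<close> are closed in the FK model, so \<open>x\<close> itself need not percolate; the bound is
  transported to \<open>x\<close> along a path, which either stays in the domain or hits its boundary.\<close>

lemma height_diff_along_path:
  assumes "(x, v) \<in> {(a, b). adj a b}\<^sup>*"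
  shows "\<exists>N::int. \<forall>V E. fin_conn_subgraph adj V E \<and> x \<in> V \<longrightarrow>
    (\<forall>h\<in>heights1 adj V E. \<bar>h x - 1\<bar> \<le> N) \<or> v \<in> V \<and> (\<forall>h\<in>heights1 adj V E. \<bar>h x - h v\<bar> \<le> N)"
  using assms
proof induction
  case base
  show ?case by (intro exI[of _ 0]) simp
next
  case (step a b)
  then obtain N where N: "\<And>V E. fin_conn_subgraph adj V E \<Longrightarrow> x \<in> V \<Longrightarrow>
    (\<forall>h\<in>heights1 adj V E. \<bar>h x - 1\<bar> \<le> N) \<or> a \<in> V \<and> (\<forall>h\<in>heights1 adj V E. \<bar>h x - h a\<bar> \<le> N)"
    by blast
  show ?case
  \<comment> \<open>One more edge costs at most 2 if it lies in \<open>E\<close>; otherwise its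
    start \<open>a\<close> is a boundary vertex and the first alternative holds.\<close>
  proof (intro exI[of _ "N + 2"] allI impI)
    fix V E assume D: "fin_conn_subgraph adj V E \<and> x \<in> V"
    consider "\<forall>h\<in>heights1 adj V E. \<bar>h x - 1\<bar> \<le> N"
      | "a \<in> V" "\<forall>h\<in>heights1 adj V E. \<bar>h x - h a\<bar> \<le> N" "{a, b} \<in> E"
      | "a \<in> V" "\<forall>h\<in>heights1 adj V E. \<bar>h x - h a\<bar> \<le> N" "{a, b} \<notin> E"
      using N[of V E] D by blast
    then show "(\<forall>h\<in>heights1 adj V E. \<bar>h x - 1\<bar> \<le> N + 2) \<or>
        b \<in> V \<and> (\<forall>h\<in>heights1 adj V E. \<bar>h x - h b\<bar> \<le> N + 2)"
    proof cases
      case 1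
      have "\<bar>h x - 1\<bar> \<le> N + 2" if "h \<in> heights1 adj V E" for h
      proof -
        have "\<bar>h x - 1\<bar> \<le> N" using 1 that by blast
        then show ?thesis by linarith
      qed
      then show ?thesis by blast
    next
      case 2
      have "\<bar>h x - h b\<bar> \<le> N + 2" if h: "h \<in> heights1 adj V E" for h
      proof -
        have "\<bar>h a - h b\<bar> \<le> 2" using h 2(3) unfolding heights1_def by blast
        moreover have "\<bar>h x - h a\<bar> \<le> N" using h 2(2) by blast
        ultimately show ?thesis by linarith
      qed
      moreover have "b \<in> V" using 2(3) D by (auto simp: fin_conn_subgraph_def)
      ultimately show ?thesis by blast
    next
      case 3
      have "a \<in> bdry adj V E" using bdryI[OF 3(1) _ 3(3)] step(2) by simp
      have "\<bar>h x - 1\<bar> \<le> N + 2" if h: "h \<in> heights1 adj V E" for h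
      proof -
        have "h a = 1" using h \<open>a \<in> bdry adj V E\<close> by (simp add: heights1_def)
        moreover have "\<bar>h x - h a\<bar> \<le> N" using h 3(2) by blast
        ultimately show ?thesis by linarith
      qed
      then show ?thesis by blast
    qed
  qed
qed

theorem mainTheorem2:
  fixes adj :: "'v \<Rightarrow> 'v \<Rightarrow> bool" and c :: "'v set \<Rightarrow> real" and x :: 'v
  assumes "countable (UNIV :: 'v set)" and "infinite (UNIV :: 'v set)"
    and "\<And>v w. adj v w \<Longrightarrow> adj w v" and "\<And>v. \<not> adj v v"
    and "locally_finite adj" and "graph_connected adj"
    and "\<And>e. e \<in> gedges adj \<Longrightarrow> c e \<ge> 1"
    and "\<exists>\<mu>. wired_FK_limit adj (\<lambda>e. 1 - 1 / c e) \<mu> \<and> (AE \<omega> in \<mu>. has_inf_cluster adj \<omega>)"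
  shows "\<exists>C > 0. \<forall>V E. fin_conn_subgraph adj V E \<and> x \<in> V \<longrightarrow> hvar adj c V E x \<le> C"
proof -
  obtain \<mu> where \<mu>: "wired_FK_limit adj (\<lambda>e. 1 - 1 / c e) \<mu>" "AE \<omega> in \<mu>. has_inf_cluster adj \<omega>"
    using assms(8) by blast
  have p: "0 \<le> 1 - 1 / c e \<and> 1 - 1 / c e \<le> 1" if "e \<in> gedges adj" for e
    using assms(7)[OF that] by auto
  obtain v \<theta> where \<theta>: "\<theta> > 0" "\<And>V E. fin_conn_subgraph adj V E \<Longrightarrow> v \<in> V \<Longrightarrow>
      \<theta> \<le> fk_prob adj (\<lambda>e. 1 - 1 / c e) V E (bdry_conn adj V E v)"
    by (rule uniform_bdry_conn[OF \<mu> assms(1,2,5,6)]) (use p that in auto)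
  obtain m :: nat where m: "4 / \<theta> \<le> real m" using real_arch_simple by blast
  have "(x, v) \<in> {(a, b). adj a b}\<^sup>*" using assms(6) by (simp add: graph_connected_def)
  then obtain N where N: "\<And>V E. fin_conn_subgraph adj V E \<Longrightarrow> x \<in> V \<Longrightarrow>
    (\<forall>h\<in>heights1 adj V E. \<bar>h x - 1\<bar> \<le> N) \<or> v \<in> V \<and> (\<forall>h\<in>heights1 adj V E. \<bar>h x - h v\<bar> \<le> N)"
    using height_diff_along_path[of x v adj] by metis
  \<comment> \<open>The height at \<open>x\<close> is compared with that at \<open>v\<close> through
    \<open>(s + t)^2 \<le> 2 * s^2 + 2 * t^2\<close>: 48 is twice the 24 of
    \<open>second_moment_bound\<close>, \<open>2 * N^2\<close> pays for the path, and the 1 makes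
    positivity evident.\<close>
  let ?C = "48 * (real m)\<^sup>2 + 2 * (real_of_int N)\<^sup>2 + 1"
  show ?thesis
  proof (intro exI[of _ ?C] conjI allI impI)
    show "?C > 0" by (intro add_nonneg_pos) auto
    fix V E assume VE: "fin_conn_subgraph adj V E \<and> x \<in> V"
    then have D: "fin_conn_subgraph adj V E" "x \<in> V" by auto
    interpret height_domain adj c V E
      using D(1) bdry_nonempty[OF D(1) assms(2,6)] assms(7)
      by unfold_locales (auto simp: fin_conn_subgraph_def)
    have sq: "(real_of_int k)\<^sup>2 \<le> (real_of_int N)\<^sup>2" if "\<bar>k\<bar> \<le> N" for k
      using that by (intro abs_le_square_iff[THEN iffD1]) linarith
    show "hvar adj c V E x \<le> ?C"
    proof (rule hvar_le)
      consider "\<forall>h\<in>H. \<bar>h x - 1\<bar> \<le> N" | "v \<in> V" "\<forall>h\<in>H. \<bar>h x - h v\<bar> \<le> N" using N[OF D] by blast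
      then show "(\<Sum>h\<in>H. W h * (real_of_int (h x - 1))\<^sup>2) \<le> ?C * (\<Sum>h\<in>H. W h)"
      proof cases
        case 1
        have "(\<Sum>h\<in>H. W h * (real_of_int (h x - 1))\<^sup>2) \<le> (\<Sum>h\<in>H. W h * ?C)"
        proof (intro sum_mono mult_left_mono)
          fix h assume "h \<in> H"
          then have "(real_of_int (h x - 1))\<^sup>2 \<le> (real_of_int N)\<^sup>2" using 1 by (intro sq) blast
          then show "(real_of_int (h x - 1))\<^sup>2 \<le> ?C" using zero_le_power2[of "real m"] zero_le_power2[of "real_of_int N"] by linarith
        qed (use W_pos in \<open>auto intro: less_imp_le\<close>)
        then show ?thesis by (simp add: sum_distrib_right[symmetric] mult.commute)
      next
        case 2
        have "(\<Sum>h\<in>H. W h * (real_of_int (h x - 1))\<^sup>2)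
            \<le> (\<Sum>h\<in>H. 2 * (W h * (real_of_int (h v - 1))\<^sup>2) + W h * (2 * (real_of_int N)\<^sup>2))"
        proof (intro sum_mono)
          fix h assume "h \<in> H"
          then have d: "(real_of_int (h x - h v))\<^sup>2 \<le> (real_of_int N)\<^sup>2" using 2(2) by (intro sq) blast
          have "(s + t)\<^sup>2 \<le> 2 * s\<^sup>2 + 2 * t\<^sup>2" for s t :: real
            using sum_squares_bound[of s t] by (simp add: power2_sum)
          from this[of "real_of_int (h v - 1)" "real_of_int (h x - h v)"]
          have "(real_of_int (h x - 1))\<^sup>2 \<le> 2 * (real_of_int (h v - 1))\<^sup>2 + 2 * (real_of_int N)\<^sup>2"
            using d by simp
          from mult_left_mono[OF this less_imp_le[OF W_pos[of h]]]
          show "W h * (real_of_int (h x - 1))\<^sup>2 \<le> 2 * (W h * (real_of_int (h v - 1))\<^sup>2) + W h * (2 * (real_of_int N)\<^sup>2)"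
            by (simp add: distrib_left mult.left_commute)
        qed
        also have "\<dots> = 2 * (\<Sum>h\<in>H. W h * (real_of_int (h v - 1))\<^sup>2) + (\<Sum>h\<in>H. W h) * (2 * (real_of_int N)\<^sup>2)"
          by (simp only: sum.distrib sum_distrib_left sum_distrib_right)
        also have "\<dots> \<le> 2 * (24 * (real m)\<^sup>2 * (\<Sum>h\<in>H. W h)) + (\<Sum>h\<in>H. W h) * (2 * (real_of_int N)\<^sup>2)"
          using second_moment_bound[OF 2(1) \<theta>(1) \<theta>(2)[OF D(1) 2(1)] m] by simp
        also have "\<dots> \<le> ?C * (\<Sum>h\<in>H. W h)"
          using partition_pos by (simp add: algebra_simps)
        finally show ?thesis .
      qed
    qed
  qed
qed

end
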